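(* Let $p,q\ge2$ be integers and let $(\beta,h)\in(0,\infty)\times[0,\infty)$ be a type-II special point (this forces $(p,q)=(4,2)$). Let $\bm m_*$ be the unique global maximizer of $H_{\beta,h}$ on $\mathcal P_q$, let $\bm X\sim\mathbb P_{\beta,h,N}$, let $\bm u=(-1,1)$, and let $F_N$ be the real random variable determined by $$\bar{\bm X}_N-\bm m_*=N^{-1/6}F_N\bm u.$$ Let $Z_{F_N}$ be a random variable with density on $\mathbb R$ proportional to $\exp\left(-\frac{x^6}{6\,\mathbb E F_N^6}\right)$, and let $\Phi_{q,F_N}$ be its distribution function. Then there is a constant $C>0$ depending on $\beta,h,p$ and $q$ such that for all $N\ge1$ and every uniformly $1$-Lipschitz function $g:\mathbb R\to\mathbb R$, $$\left|\mathbb E\,g(F_N)-\mathbb E\,g(Z_{F_N})\right|\le\frac{C}{N^{1/6}},\qquad\text{and}\qquad \sup_{t\in\mathbb R}\left|\mathbb P(F_N\le t)-\Phi_{q,F_N}(t)\right|\le\frac{C}{N^{1/6}}.$$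
   Context: For integers $p,q\ge2$, $\beta>0$, $h\ge0$, $N\ge1$, with $[m]=\{1,\dots,m\}$, the $p$-tensor Curie–Weiss Potts model is the probability measure on $[q]^N$ $$\mathbb P_{\beta,h,N}(\bm X)=\frac{1}{q^N Z_N(\beta,h)}\exp\Big(\beta N\sum_{r=1}^q \bar X_{\cdot r}^p+Nh\bar X_{\cdot 1}\Big),\qquad \bm X=(X_1,\dots,X_N)\in[q]^N,$$ where $\bar X_{\cdot r}:=N^{-1}\sum_{i=1}^N \mathbb 1_{X_i=r}$ and $Z_N(\beta,h)$ is the normalizing constant. The magnetization vector is $\bar{\bm X}_N:=(\bar X_{\cdot1},\dots,\bar X_{\cdot q})^\top$. $\mathcal P_q$ is the set of $q$-dimensional probability vectors, and $H_{\beta,h}:\mathcal P_q\to\mathbb R$ is $H_{\beta,h}(\bm t)=\beta\sum_{r=1}^q t_r^p+ht_1-\sum_{r=1}^q t_r\log t_r$ (with $0\log0=0$). Let $\mathcal H_q=\{\bm t\in\mathbb R^q:\sum_r t_r=0\}$ and, for $\bm v\in\mathcal P_q$ with positive entries, $\bm Q_{\bm v,\beta}(\bm t)=\sum_{r=1}^q\big(\beta p(p-1)v_r^{p-2}-\tfrac1{v_r}\big)t_r^2$. For $s\in[0,1)$ let $\bm x_s=\big(\frac{1+(q-1)s}{q},\frac{1-s}{q},\dots,\frac{1-s}{q}\big)\in\mathcal P_q$ and $f_{\beta,h}(s)=H_{\beta,h}(\bm x_s)$; global maximizers of $H_{\beta,h}$ are permutations of vectors $\bm x_s$ with $s\in[0,1)$.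 The point $(\beta,h)$ is special if $H_{\beta,h}$ has a unique global maximizer $\bm m_*$ and $\bm Q_{\bm m_*,\beta}$ is singular on $\mathcal H_q$ (i.e. $\mathrm{Ker}(\bm Q_{\bm m_*,\beta})\cap\mathcal H_q\ne\{\boldsymbol 0\}$). A special point is of type II if, writing $\bm m_*=\bm x_s$, the fourth derivative satisfies $f^{(4)}_{\beta,h}(s)=0$. It is known that type-II special points exist only when $(p,q)=(4,2)$. *)

theory Defs
  imports "HOL-Probability.Probability"
begin

text \<open>
  Vectors of length \<open>q\<close> are extensional functions on \<open>{1..q}\<close>, so that equality of vectors
  (hence uniqueness of a maximizer) is equality of functions.
\<close>

definition vecs :: "nat \<Rightarrow> (nat \<Rightarrow> real) set" where
  "vecs q = {1..q} \<rightarrow>\<^sub>E UNIV"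

definition prob_vecs :: "nat \<Rightarrow> (nat \<Rightarrow> real) set" where
  "prob_vecs q = {t \<in> vecs q. (\<forall>r\<in>{1..q}. 0 \<le> t r) \<and> (\<Sum>r\<in>{1..q}. t r) = 1}"

definition zero_sum_vecs :: "nat \<Rightarrow> (nat \<Rightarrow> real) set" where
  "zero_sum_vecs q = {t \<in> vecs q. (\<Sum>r\<in>{1..q}. t r) = 0}"

definition configs :: "nat \<Rightarrow> nat \<Rightarrow> (nat \<Rightarrow> nat) set" where
  "configs q N = {1..N} \<rightarrow>\<^sub>E {1..q}"

definition magnetization :: "nat \<Rightarrow> (nat \<Rightarrow> nat) \<Rightarrow> nat \<Rightarrow> real" where
  "magnetization N X r = (\<Sum>i\<in>{1..N}. of_bool (X i = r)) / real N"

definition potts_weight :: "nat \<Rightarrow> nat \<Rightarrow> real \<Rightarrow> real \<Rightarrow> nat \<Rightarrow> (nat \<Rightarrow> nat) \<Rightarrow> real" where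
  "potts_weight p q \<beta> h N X =
     exp (\<beta> * real N * (\<Sum>r\<in>{1..q}. magnetization N X r ^ p) + real N * h * magnetization N X 1)"

definition potts_Z :: "nat \<Rightarrow> nat \<Rightarrow> real \<Rightarrow> real \<Rightarrow> nat \<Rightarrow> real" where
  "potts_Z p q \<beta> h N = (\<Sum>X\<in>configs q N. potts_weight p q \<beta> h N X) / real q ^ N"

definition potts :: "nat \<Rightarrow> nat \<Rightarrow> real \<Rightarrow> real \<Rightarrow> nat \<Rightarrow> (nat \<Rightarrow> nat) measure" where
  "potts p q \<beta> h N = point_measure (configs q N)
     (\<lambda>X. ennreal (1 / (real q ^ N * potts_Z p q \<beta> h N) * potts_weight p q \<beta> h N X))"

text \<open>The convention \<open>0 log 0 = 0\<close> holds automatically because of the factor \<open>t r\<close>.\<close>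

definition H_fun :: "nat \<Rightarrow> nat \<Rightarrow> real \<Rightarrow> real \<Rightarrow> (nat \<Rightarrow> real) \<Rightarrow> real" where
  "H_fun p q \<beta> h t = \<beta> * (\<Sum>r\<in>{1..q}. t r ^ p) + h * t 1 - (\<Sum>r\<in>{1..q}. t r * ln (t r))"

definition global_maximizer :: "nat \<Rightarrow> nat \<Rightarrow> real \<Rightarrow> real \<Rightarrow> (nat \<Rightarrow> real) \<Rightarrow> bool" where
  "global_maximizer p q \<beta> h m \<longleftrightarrow> is_arg_max (H_fun p q \<beta> h) (\<lambda>t. t \<in> prob_vecs q) m"

definition unique_global_maximizer :: "nat \<Rightarrow> nat \<Rightarrow> real \<Rightarrow> real \<Rightarrow> (nat \<Rightarrow> real) \<Rightarrow> bool" where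
  "unique_global_maximizer p q \<beta> h m \<longleftrightarrow>
     global_maximizer p q \<beta> h m \<and> (\<forall>m'. global_maximizer p q \<beta> h m' \<longrightarrow> m' = m)"

definition Q_form :: "nat \<Rightarrow> nat \<Rightarrow> (nat \<Rightarrow> real) \<Rightarrow> real \<Rightarrow> (nat \<Rightarrow> real) \<Rightarrow> real" where
  "Q_form p q v \<beta> t =
     (\<Sum>r\<in>{1..q}. (\<beta> * real p * (real p - 1) * v r ^ (p - 2) - 1 / v r) * (t r)\<^sup>2)"

text \<open>
  The kernel of a quadratic form is its zero set. At a global maximizer the form is negative
  semidefinite on zero-sum vectors, so its zeros there are exactly the radical of its
  restriction.
\<close>

definition Ker :: "nat \<Rightarrow> ((nat \<Rightarrow> real) \<Rightarrow> real) \<Rightarrow> (nat \<Rightarrow> real) set" where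
  "Ker q B = {t \<in> vecs q. B t = 0}"

definition special :: "nat \<Rightarrow> nat \<Rightarrow> real \<Rightarrow> real \<Rightarrow> bool" where
  "special p q \<beta> h \<longleftrightarrow>
     (\<exists>m. unique_global_maximizer p q \<beta> h m \<and>
          Ker q (Q_form p q m \<beta>) \<inter> zero_sum_vecs q \<noteq> {\<lambda>r\<in>{1..q}. 0})"

definition x_vec :: "nat \<Rightarrow> real \<Rightarrow> nat \<Rightarrow> real" where
  "x_vec q s = (\<lambda>r\<in>{1..q}. if r = 1 then (1 + (real q - 1) * s) / real q else (1 - s) / real q)"

text \<open>
  The formula is used for all real \<open>s\<close>, so derivatives at \<open>s = 0\<close> are two-sided; for
  \<open>-1/(q-1) < s < 1\<close> the vector \<open>x_vec q s\<close> is a probability vector with positive entries.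
\<close>

definition f_fun :: "nat \<Rightarrow> nat \<Rightarrow> real \<Rightarrow> real \<Rightarrow> real \<Rightarrow> real" where
  "f_fun p q \<beta> h s = H_fun p q \<beta> h (x_vec q s)"

definition special_type_II :: "nat \<Rightarrow> nat \<Rightarrow> real \<Rightarrow> real \<Rightarrow> bool" where
  "special_type_II p q \<beta> h \<longleftrightarrow>
     special p q \<beta> h \<and>
     (\<exists>s\<in>{0..<1}. unique_global_maximizer p q \<beta> h (x_vec q s) \<and> (deriv ^^ 4) (f_fun p q \<beta> h) s = 0)"

text \<open>
  The direction \<open>(-1, 1)\<close> lives in the plane, i.e. \<open>q = 2\<close>; the padding by \<open>0\<close> only makes it a
  total function. For \<open>q = 2\<close> exactly one \<open>F\<close> on \<open>configs q N\<close> satisfies the vector equation in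
  \<open>is_fluctuation\<close>, since both sides have zero-sum coordinates.
\<close>

definition u_vec :: "nat \<Rightarrow> real" where
  "u_vec r = (if r = 1 then -1 else if r = 2 then 1 else 0)"

definition is_fluctuation ::
    "nat \<Rightarrow> nat \<Rightarrow> (nat \<Rightarrow> real) \<Rightarrow> ((nat \<Rightarrow> nat) \<Rightarrow> real) \<Rightarrow> bool" where
  "is_fluctuation q N m F \<longleftrightarrow>
     (\<forall>X\<in>configs q N. \<forall>r\<in>{1..q}.
        magnetization N X r - m r = real N powr (- 1 / 6) * F X * u_vec r)"

definition sextic_law :: "real \<Rightarrow> real measure" where
  "sextic_law a = density lborel
     (\<lambda>x. ennreal (exp (- (x ^ 6 / (6 * a))) / (LINT y|lborel. exp (- (y ^ 6 / (6 * a))))))"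

end

theory Submission
  imports Defs "HOL-Real_Asymp.Real_Asymp"
begin

text \<open>
  If \<open>q \<ge> 3\<close>, no \<open>F\<close> solves the vector equation: the third coordinate of the direction vanishes,
  while the third magnetization takes different values on different configurations.  So let
  \<open>q = 2\<close>.  At a type-II special point the second, third and fourth derivatives of \<open>f\<close> vanish at
  the maximizer.  This algebraic system in the two colour fractions forces \<open>p = 4\<close>, equal fractions
  and \<open>\<beta> = 2/3\<close>, and then \<open>h = 0\<close> because the first derivative vanishes too
  (\<open>special_type_II_parameters\<close>).  The model is now completely explicit.

  Put \<open>e = N\<^sup>-\<^sup>1\<^sup>/\<^sup>6\<close> and let \<open>s = 2 e F\<close> be the difference of the two colour fractions.  The variable
  \<open>F\<close> lives on a lattice of mesh \<open>1 / (N e) = e\<^sup>5\<close>, and recolouring one site gives the exact identity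
  \<open>E [(1 - s) exp (\<Delta>) g (F + e\<^sup>5)] = E [(1 + s) g F]\<close> for every function \<open>g\<close>, where the energy
  increment is \<open>\<Delta> = 2 s + 2 s\<^sup>3 / 3 + O(1/N)\<close> (\<open>gibbs_mean_flip\<close>).  The logarithm of
  \<open>(1 - s) / (1 + s)\<close> is \<open>- 2 (s + s\<^sup>3 / 3 + s\<^sup>5 / 5 + \<dots>)\<close>, so energy and entropy cancel up to
  order four and what remains is the drift \<open>- 2/5 s\<^sup>5 + O(s\<^sup>6)\<close>.  After division by \<open>e\<^sup>5\<close> this says that
  \<open>E [g' F - 64/5 F\<^sup>5 g F] = O(e)\<close>, which is, up to the error, the Stein characterization
  of the density proportional to \<open>exp (- 32/15 x\<^sup>6)\<close>.

  This identity is used with three choices of \<open>g\<close>.  With \<open>g x = x\<^sup>3\<close>, since the drift pushes inwards with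
  strength at least a multiple of \<open>\<bar>s\<bar>\<^sup>5\<close> on all of \<open>[-1, 1]\<close> (\<open>drift_coercive\<close>), it bounds
  \<open>E F\<^sup>8\<close> uniformly in \<open>N\<close>.  With \<open>g x = x\<close> it gives \<open>E F\<^sup>6 = 5/64 + O(e)\<close>, so normalizing the limit law
  by the sixth moment of \<open>F\<close> itself costs only \<open>O(e)\<close>.  With \<open>g\<close> the solution of the Stein equation
  of the law so normalized (\<open>sextic_stein_solution\<close>) it bounds the difference of expectations of
  any test function of linear growth with Lipschitz constant at most \<open>1/e\<close>
  (\<open>stein_comparison\<close>).  Such functions include the 1-Lipschitz ones, up to an additive
  constant, and the ramps of width \<open>e\<close>; since the limit density is bounded, replacing an indicator
  by a ramp costs again only \<open>O(e)\<close>, and the Kolmogorov bound follows.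
\<close>

section \<open>Degenerate maximizers with two colours\<close>

text \<open>
  Here \<open>a\<close>, \<open>b\<close> are the colour fractions, \<open>r = p - 2\<close>, and the equations say that the second, third
  and fourth derivatives of \<open>f\<close> vanish.  The first two are linear in \<open>B a\<^sup>k\<close> and \<open>B b\<^sup>k\<close>, where
  \<open>k = r - 2\<close>.  Substituting their solution into the third gives \<open>a\<^sup>2 + b\<^sup>2 = r a b\<close>, and then the
  solution itself shows \<open>a\<^sup>k = b\<^sup>k\<close>.
\<close>

lemma degenerate_point_algebra:
  fixes a b B :: real and r :: nat
  assumes a: "a > 0" and b: "b > 0"
    and e2: "B * (a ^ r + b ^ r) = 1 / a + 1 / b"
    and e3: "B * (real r * a ^ (r - 1) - real r * b ^ (r - 1)) = 1 / b\<^sup>2 - 1 / a\<^sup>2"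
    and e4: "B * (real r * real (r - 1) * a ^ (r - 2) + real r * real (r - 1) * b ^ (r - 2))
               = 2 / a ^ 3 + 2 / b ^ 3"
  shows "r = 2 \<and> a = b"
proof -
  have "2 / a ^ 3 + 2 / b ^ 3 > 0"
    using a b by (simp add: add_pos_pos)
  with e4 have "real r * real (r - 1) \<noteq> 0"
    by (auto simp: algebra_simps)
  then have "r \<ge> 2"
    by (cases r) (auto simp: numeral_2_eq_2)
  then obtain k where r: "r = k + 2"
    by (metis add.commute le_Suc_ex)
  define n :: real where "n = real k + 2"
  define A where "A = B * a ^ k * a ^ 3 * b ^ 3"
  define D where "D = B * b ^ k * a ^ 3 * b ^ 3"
  have n: "n \<ge> 2" by (simp add: n_def)
  have ab: "a + b > 0" "a * b > 0" using a b by auto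
  have pw: "a ^ (k + 2) = a ^ k * a\<^sup>2" "b ^ (k + 2) = b ^ k * b\<^sup>2" by (simp_all only: power_add)
  have f2: "a\<^sup>2 * A + b\<^sup>2 * D = a\<^sup>2 * b\<^sup>2 * (a + b)"
  proof -
    have "a\<^sup>2 * A + b\<^sup>2 * D = a ^ 3 * b ^ 3 * (B * (a ^ r + b ^ r))"
      unfolding A_def D_def r pw by (simp add: algebra_simps)
    also have "\<dots> = a\<^sup>2 * b\<^sup>2 * (a + b)"
      unfolding e2 using a b by (simp add: field_simps power2_eq_square power3_eq_cube)
    finally show ?thesis .
  qed
  have f3: "n * (a * A - b * D) = a * b * (a - b) * (a + b)"
  proof -
    have "n * (a * A - b * D) = a ^ 3 * b ^ 3 * (B * (real r * a ^ (r - 1) - real r * b ^ (r - 1)))"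
      unfolding A_def D_def r n_def by (simp add: algebra_simps)
    also have "\<dots> = a * b * (a - b) * (a + b)"
      unfolding e3 using a b by (simp add: field_simps power2_eq_square power3_eq_cube)
    finally show ?thesis .
  qed
  have f4: "n * (n - 1) * (A + D) = 2 * (a ^ 3 + b ^ 3)"
  proof -
    have "n * (n - 1) * (A + D) = a ^ 3 * b ^ 3 *
       (B * (real r * real (r - 1) * a ^ (r - 2) + real r * real (r - 1) * b ^ (r - 2)))"
      unfolding A_def D_def r n_def by (simp add: algebra_simps)
    also have "\<dots> = 2 * (a ^ 3 + b ^ 3)"
      unfolding e4 using a b by (simp add: field_simps)
    finally show ?thesis .
  qed
  have nA: "n * A = b\<^sup>2 * ((n + 1) * a - b)"
  proof -
    have "(a * (a + b)) * (n * A) = (a * (a + b)) * (b\<^sup>2 * ((n + 1) * a - b))"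
      using f2 f3 by algebra
    then show ?thesis using a ab by auto
  qed
  have nD: "n * D = a\<^sup>2 * ((n + 1) * b - a)"
  proof -
    have "(b * (a + b)) * (n * D) = (b * (a + b)) * (a\<^sup>2 * ((n + 1) * b - a))"
      using f2 f3 by algebra
    then show ?thesis using b ab by auto
  qed
  have q: "a\<^sup>2 + b\<^sup>2 = n * a * b"
  proof -
    have "((n + 1) * (a + b)) * (a\<^sup>2 + b\<^sup>2) = ((n + 1) * (a + b)) * (n * a * b)"
      using f4 nA nD by algebra
    then show ?thesis using n ab by auto
  qed
  \<comment> \<open>Both sides equal \<open>a b (a + b)\<close>.\<close>
  have "n * A = n * D"
    using nA nD q by algebra
  then have "B * a ^ k = B * b ^ k"
    using n a b by (simp add: A_def D_def)
  moreover have "B \<noteq> 0"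
    using e2 a b by (auto simp: field_simps)
  ultimately have "a ^ k = b ^ k" by simp
  then have "k = 0 \<or> a = b"
    using a b by (meson less_imp_le power_eq_iff_eq_base zero_less_iff_neq_zero)
  then show ?thesis
  proof
    assume k: "k = 0"
    with q have "(a - b)\<^sup>2 = 0" by (simp add: n_def power2_diff)
    then show ?thesis using k r by simp
  next
    assume e: "a = b"
    with q have "n * (a * a) = 2 * (a * a)" by (simp add: power2_eq_square)
    then have "n = 2" using a by simp
    then show ?thesis using e r by (simp add: n_def)
  qed
qed

text \<open>
  Otherwise the cubic term of the Taylor expansion would dominate and be positive on one side.
\<close>

lemma third_derivative_zero_at_local_max:
  fixes f f1 f2 f3 :: "real \<Rightarrow> real"
  assumes d: "d > 0"
    and D1: "\<And>x. \<bar>x - s\<bar> < d \<Longrightarrow> (f has_real_derivative f1 x) (at x)"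
    and D2: "\<And>x. \<bar>x - s\<bar> < d \<Longrightarrow> (f1 has_real_derivative f2 x) (at x)"
    and D3: "\<And>x. \<bar>x - s\<bar> < d \<Longrightarrow> (f2 has_real_derivative f3 x) (at x)"
    and cont: "isCont f3 s"
    and z: "f1 s = 0" "f2 s = 0"
    and max: "\<And>x. \<bar>x - s\<bar> < d \<Longrightarrow> f x \<le> f s"
  shows "f3 s = 0"
proof (rule ccontr)
  assume nz: "f3 s \<noteq> 0"
  define e where "e = \<bar>f3 s\<bar>"
  have "e > 0" using nz by (simp add: e_def)
  then obtain \<eta> where \<eta>: "\<eta> > 0" "\<And>x. \<bar>x - s\<bar> < \<eta> \<Longrightarrow> \<bar>f3 x - f3 s\<bar> < e"
    using cont unfolding continuous_at_eps_delta dist_real_def by (metis abs_minus_commute)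
  define k where "k = min d \<eta> / 2"
  have k: "k > 0" "k < d" "k < \<eta>" using d \<eta> by (auto simp: k_def min_def)
  define diff where "diff = (\<lambda>m::nat. if m = 0 then f else if m = 1 then f1 else if m = 2 then f2 else f3)"
  have der: "\<forall>m t. m < 3 \<and> s - k \<le> t \<and> t \<le> s + k \<longrightarrow> DERIV (diff m) t :> diff (Suc m) t"
  proof (intro allI impI)
    fix m :: nat and t
    assume A: "m < 3 \<and> s - k \<le> t \<and> t \<le> s + k"
    then have "\<bar>t - s\<bar> < d" using k by (auto simp: abs_less_iff)
    moreover have "m = 0 \<or> m = 1 \<or> m = 2" using A by auto
    ultimately show "DERIV (diff m) t :> diff (Suc m) t"
      using D1 D2 D3 by (auto simp: diff_def)
  qed
  \<comment> \<open>Step to the side on which the cubic term is positive.\<close>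
  define x where "x = (if f3 s > 0 then s + k else s - k)"
  have T: "\<exists>t. (if x < s then x < t \<and> t < s else s < t \<and> t < x) \<and>
    f x = (\<Sum>m<3. diff m s / fact m * (x - s) ^ m) + diff 3 t / fact 3 * (x - s) ^ 3"
    by (rule Taylor[OF _ _ der]) (use k in \<open>auto simp: x_def diff_def\<close>)
  then obtain t where t: "if x < s then x < t \<and> t < s else s < t \<and> t < x"
    and fx: "f x = (\<Sum>m<3. diff m s / fact m * (x - s) ^ m) + diff 3 t / fact 3 * (x - s) ^ 3"
    by blast
  have "f x = f s + f3 t / 6 * (x - s) ^ 3"
    using fx z by (simp add: diff_def eval_nat_numeral)
  moreover have "f x \<le> f s" using k by (intro max) (auto simp: x_def)
  ultimately have le: "f3 t * (x - s) ^ 3 \<le> 0" by simp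
  have "\<bar>t - s\<bar> < \<eta>" using t k by (auto simp: x_def split: if_splits)
  then have "\<bar>f3 t - f3 s\<bar> < \<bar>f3 s\<bar>" using \<eta> by (auto simp: e_def)
  then have "f3 t * f3 s > 0" and same: "f3 s > 0 \<longleftrightarrow> f3 t > 0"
    using nz by (auto simp: abs_less_iff abs_if zero_less_mult_iff split: if_splits)
  then have "f3 t * (x - s) ^ 3 > 0"
  proof (cases "f3 s > 0")
    case True
    then show ?thesis using same k by (simp add: x_def)
  next
    case False
    then have "f3 t < 0" using same \<open>f3 t * f3 s > 0\<close> by (auto simp: zero_less_mult_iff)
    moreover have "(x - s) ^ 3 < 0" using False k by (simp add: x_def)
    ultimately show ?thesis by (simp add: mult_neg_neg)
  qed
  with le show False by simp
qed

lemma atLeastAtMost_1_2: "{1..2::nat} = {1, 2}" by auto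

lemma x_vec_2:
  "x_vec 2 s 1 = (1 + s) / 2" "x_vec 2 s (Suc 0) = (1 + s) / 2" "x_vec 2 s 2 = (1 - s) / 2"
  by (simp_all add: x_vec_def)

lemma x_vec_2_prob:
  assumes "\<bar>s\<bar> \<le> 1"
  shows "x_vec 2 s \<in> prob_vecs 2"
proof -
  have "-1 \<le> s" "s \<le> 1" using assms by linarith+
  then have "0 \<le> x_vec 2 s r" if "r \<in> {1, 2}" for r
    using that by (elim insertE emptyE) (simp_all only: x_vec_2, simp_all)
  moreover have "(\<Sum>r\<in>{1, 2}. x_vec 2 s r) = 1"
  proof -
    have "(\<Sum>r\<in>{1::nat, 2}. x_vec 2 s r) = x_vec 2 s 1 + x_vec 2 s 2" by simp
    also have "\<dots> = 1" unfolding x_vec_2 by (simp add: field_simps)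
    finally show ?thesis .
  qed
  moreover have "x_vec 2 s \<in> {1..2} \<rightarrow>\<^sub>E UNIV" unfolding x_vec_def by auto
  ultimately show ?thesis
    unfolding prob_vecs_def vecs_def atLeastAtMost_1_2 by blast
qed

lemma f_fun_2:
  "f_fun p 2 \<beta> h s = \<beta> * (((1 + s) / 2) ^ p + ((1 - s) / 2) ^ p) + h * ((1 + s) / 2)
     - ((1 + s) / 2 * ln ((1 + s) / 2) + (1 - s) / 2 * ln ((1 - s) / 2))"
  unfolding f_fun_def H_fun_def atLeastAtMost_1_2 by (simp add: x_vec_2)

lemma deriv_cong_open:
  fixes f g :: "real \<Rightarrow> real"
  assumes "open S" "\<And>x. x \<in> S \<Longrightarrow> f x = g x"
    and "\<And>x. x \<in> S \<Longrightarrow> (g has_real_derivative g' x) (at x)" "x \<in> S"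
  shows "deriv f x = g' x"
proof -
  have "eventually (\<lambda>y. f y = g y) (nhds x)"
    using assms by (auto simp: eventually_nhds)
  then have "deriv f x = deriv g x" by (intro deriv_cong_ev) auto
  also have "\<dots> = g' x" using assms by (intro DERIV_imp_deriv) auto
  finally show ?thesis .
qed

text \<open>
  Keeping the two fractions as opaque functions \<open>u\<close>, \<open>v\<close> of slope \<open>1/2\<close> and \<open>- 1/2\<close> leaves only
  identities between monomials to be checked.
\<close>

lemma entropy_energy_derivatives:
  fixes u v :: "real \<Rightarrow> real" and r :: nat
  assumes u: "(u has_real_derivative 1 / 2) (at x)" "u x > 0"
    and v: "(v has_real_derivative - 1 / 2) (at x)" "v x > 0"
  shows "((\<lambda>s. \<beta> * (u s ^ (r + 2) + v s ^ (r + 2)) + h * u s - (u s * ln (u s) + v s * ln (v s)))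
      has_real_derivative
        \<beta> * real (r + 2) / 2 * (u x ^ (r + 1) - v x ^ (r + 1)) + h / 2 - (ln (u x) - ln (v x)) / 2) (at x)"
    and "((\<lambda>s. \<beta> * real (r + 2) / 2 * (u s ^ (r + 1) - v s ^ (r + 1)) + h / 2 - (ln (u s) - ln (v s)) / 2)
      has_real_derivative
        \<beta> * real (r + 2) * (real (r + 2) - 1) / 4 * (u x ^ r + v x ^ r) - (1 / u x + 1 / v x) / 4) (at x)"
    and "((\<lambda>s. B / 4 * (u s ^ r + v s ^ r) - (1 / u s + 1 / v s) / 4) has_real_derivative
        B / 8 * (real r * u x ^ (r - 1) - real r * v x ^ (r - 1)) + (1 / (u x)\<^sup>2 - 1 / (v x)\<^sup>2) / 8) (at x)"
    and "((\<lambda>s. B / 8 * (real r * u s ^ (r - 1) - real r * v s ^ (r - 1)) + (1 / (u s)\<^sup>2 - 1 / (v s)\<^sup>2) / 8)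
      has_real_derivative
        B / 16 * (real r * real (r - 1) * u x ^ (r - 2) + real r * real (r - 1) * v x ^ (r - 2))
          - (1 / u x ^ 3 + 1 / v x ^ 3) / 8) (at x)"
proof -
  have pu: "((\<lambda>s. u s ^ n) has_real_derivative real n * u x ^ (n - 1) / 2) (at x)" for n
    by (rule derivative_eq_intros u refl)+ simp
  have pv: "((\<lambda>s. v s ^ n) has_real_derivative - (real n * v x ^ (n - 1) / 2)) (at x)" for n
    by (rule derivative_eq_intros v refl)+ simp
  have lu: "((\<lambda>s. ln (u s)) has_real_derivative 1 / u x / 2) (at x)"
    using u by (auto intro!: derivative_eq_intros)
  have lv: "((\<lambda>s. ln (v s)) has_real_derivative - (1 / v x / 2)) (at x)"
    using v by (auto intro!: derivative_eq_intros)
  have ulu: "((\<lambda>s. u s * ln (u s)) has_real_derivative ln (u x) / 2 + 1 / 2) (at x)"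
    by (rule DERIV_cong[OF DERIV_mult[OF u(1) lu]]) (use u in simp)
  have vlv: "((\<lambda>s. v s * ln (v s)) has_real_derivative - (ln (v x) / 2) - 1 / 2) (at x)"
    by (rule DERIV_cong[OF DERIV_mult[OF v(1) lv]]) (use v in simp)
  have iu: "((\<lambda>s. 1 / u s) has_real_derivative - (1 / (u x)\<^sup>2 / 2)) (at x)"
    using u by (auto intro!: derivative_eq_intros simp: power2_eq_square)
  have iv: "((\<lambda>s. 1 / v s) has_real_derivative 1 / (v x)\<^sup>2 / 2) (at x)"
    using v by (auto intro!: derivative_eq_intros simp: power2_eq_square)
  have iu2: "((\<lambda>s. 1 / (u s)\<^sup>2) has_real_derivative - (1 / u x ^ 3)) (at x)"
    by (rule derivative_eq_intros u refl)+ (use u in \<open>simp_all add: field_simps eval_nat_numeral\<close>)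
  have iv2: "((\<lambda>s. 1 / (v s)\<^sup>2) has_real_derivative 1 / v x ^ 3) (at x)"
    by (rule derivative_eq_intros v refl)+ (use v in \<open>simp_all add: field_simps eval_nat_numeral\<close>)
  show "((\<lambda>s. \<beta> * (u s ^ (r + 2) + v s ^ (r + 2)) + h * u s - (u s * ln (u s) + v s * ln (v s)))
      has_real_derivative
        \<beta> * real (r + 2) / 2 * (u x ^ (r + 1) - v x ^ (r + 1)) + h / 2 - (ln (u x) - ln (v x)) / 2) (at x)"
    by (rule ulu vlv pu pv u(1) derivative_eq_intros refl)+ (simp add: algebra_simps diff_divide_distrib add_divide_distrib)
  show "((\<lambda>s. \<beta> * real (r + 2) / 2 * (u s ^ (r + 1) - v s ^ (r + 1)) + h / 2 - (ln (u s) - ln (v s)) / 2)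
      has_real_derivative
        \<beta> * real (r + 2) * (real (r + 2) - 1) / 4 * (u x ^ r + v x ^ r) - (1 / u x + 1 / v x) / 4) (at x)"
    by (rule DERIV_cong, (rule pu pv lu lv DERIV_add DERIV_diff DERIV_cmult DERIV_cdivide DERIV_const)+) (simp_all add: algebra_simps diff_divide_distrib add_divide_distrib)
  show "((\<lambda>s. B / 4 * (u s ^ r + v s ^ r) - (1 / u s + 1 / v s) / 4) has_real_derivative
        B / 8 * (real r * u x ^ (r - 1) - real r * v x ^ (r - 1)) + (1 / (u x)\<^sup>2 - 1 / (v x)\<^sup>2) / 8) (at x)"
    by (rule DERIV_cong, (rule pu pv iu iv DERIV_add DERIV_diff DERIV_cmult DERIV_cdivide)+) (simp_all add: algebra_simps diff_divide_distrib add_divide_distrib)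
  show "((\<lambda>s. B / 8 * (real r * u s ^ (r - 1) - real r * v s ^ (r - 1)) + (1 / (u s)\<^sup>2 - 1 / (v s)\<^sup>2) / 8)
      has_real_derivative
        B / 16 * (real r * real (r - 1) * u x ^ (r - 2) + real r * real (r - 1) * v x ^ (r - 2))
          - (1 / u x ^ 3 + 1 / v x ^ 3) / 8) (at x)"
    by (rule DERIV_cong, (rule pu pv iu2 iv2 DERIV_add DERIV_diff DERIV_cmult DERIV_cdivide)+) (simp_all add: algebra_simps diff_divide_distrib add_divide_distrib numeral_2_eq_2)
qed

lemma special_type_II_parameters:
  assumes p: "p \<ge> 2" and "special_type_II p 2 \<beta> h" and m: "unique_global_maximizer p 2 \<beta> h m"
  shows "p = 4" "\<beta> = 2 / 3" "h = 0" "m = x_vec 2 0"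
proof -
  obtain s where s: "0 \<le> s" "s < 1" and us: "unique_global_maximizer p 2 \<beta> h (x_vec 2 s)"
    and d4: "(deriv ^^ 4) (f_fun p 2 \<beta> h) s = 0" and sp: "special p 2 \<beta> h"
    using assms(2) unfolding special_type_II_def by auto
  have ms: "m = x_vec 2 s"
    using us m unfolding unique_global_maximizer_def by blast
  obtain r where r: "p = r + 2" using p by (metis add.commute le_Suc_ex)
  define B where "B = \<beta> * real p * (real p - 1)"
  define a where "a = (1 + s) / 2"
  define b where "b = (1 - s) / 2"
  have ab: "a > 0" "b > 0" using s by (auto simp: a_def b_def)
  \<comment> \<open>With \<open>p = r + 2\<close>, subtraction in an exponent truncates only where its coefficient vanishes.\<close>
  define f1 where "f1 = (\<lambda>s. \<beta> * real p / 2 * (((1 + s) / 2) ^ (r + 1) - ((1 - s) / 2) ^ (r + 1)) + h / 2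
      - (ln ((1 + s) / 2) - ln ((1 - s) / 2)) / 2)"
  define f2 where "f2 = (\<lambda>s. B / 4 * (((1 + s) / 2) ^ r + ((1 - s) / 2) ^ r)
      - (1 / ((1 + s) / 2) + 1 / ((1 - s) / 2)) / 4)"
  define f3 where "f3 = (\<lambda>s. B / 8 * (real r * ((1 + s) / 2) ^ (r - 1) - real r * ((1 - s) / 2) ^ (r - 1))
      + (1 / ((1 + s) / 2)\<^sup>2 - 1 / ((1 - s) / 2)\<^sup>2) / 8)"
  define f4 where "f4 = (\<lambda>s. B / 16 * (real r * real (r - 1) * ((1 + s) / 2) ^ (r - 2)
      + real r * real (r - 1) * ((1 - s) / 2) ^ (r - 2))
      - (1 / ((1 + s) / 2) ^ 3 + 1 / ((1 - s) / 2) ^ 3) / 8)"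
  let ?S = "{-1<..<1::real}"
  have du: "((\<lambda>s. (1 + s) / 2) has_real_derivative 1 / 2) (at x)"
    and dv: "((\<lambda>s. (1 - s) / 2) has_real_derivative - 1 / 2) (at x)" for x :: real
    by (auto intro!: derivative_eq_intros)
  have D1: "(f_fun p 2 \<beta> h has_real_derivative f1 x) (at x)" if x: "x \<in> ?S" for x
    unfolding f_fun_2[abs_def] f1_def r using x by (intro entropy_energy_derivatives(1) du dv) auto
  have D2: "(f1 has_real_derivative f2 x) (at x)" if x: "x \<in> ?S" for x
    unfolding f1_def f2_def B_def r using x by (intro entropy_energy_derivatives(2) du dv) auto
  have D3: "(f2 has_real_derivative f3 x) (at x)" if x: "x \<in> ?S" for x
    unfolding f2_def f3_def using x by (intro entropy_energy_derivatives(3) du dv) auto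
  have D4: "(f3 has_real_derivative f4 x) (at x)" if x: "x \<in> ?S" for x
    unfolding f3_def f4_def using x by (intro entropy_energy_derivatives(4) du dv) auto
  have oS: "open ?S" and sS: "s \<in> ?S" using s by auto
  have "(deriv ^^ 4) (f_fun p 2 \<beta> h) s = f4 s"
  proof -
    have e1: "deriv (f_fun p 2 \<beta> h) x = f1 x" if "x \<in> ?S" for x
      using that by (intro deriv_cong_open[OF oS _ D1]) auto
    have e2: "deriv (deriv (f_fun p 2 \<beta> h)) x = f2 x" if "x \<in> ?S" for x
      using that e1 by (intro deriv_cong_open[OF oS _ D2]) auto
    have e3: "deriv (deriv (deriv (f_fun p 2 \<beta> h))) x = f3 x" if "x \<in> ?S" for x
      using that e2 by (intro deriv_cong_open[OF oS _ D3]) auto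
    have e4: "deriv (deriv (deriv (deriv (f_fun p 2 \<beta> h)))) x = f4 x" if "x \<in> ?S" for x
      using that e3 by (intro deriv_cong_open[OF oS _ D4]) auto
    show ?thesis using e4[OF sS] by (simp add: eval_nat_numeral)
  qed
  with d4 have z4: "f4 s = 0" by simp
  have max: "f_fun p 2 \<beta> h x \<le> f_fun p 2 \<beta> h s" if "x \<in> ?S" for x
  proof -
    have "x_vec 2 x \<in> prob_vecs 2" using that by (intro x_vec_2_prob) auto
    then show ?thesis
      using us unfolding unique_global_maximizer_def global_maximizer_def is_arg_max_linorder f_fun_def
      by blast
  qed
  define d where "d = 1 - s"
  have d: "d > 0" "\<And>x. \<bar>x - s\<bar> < d \<Longrightarrow> x \<in> ?S" using s by (auto simp: d_def abs_less_iff)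
  have z1: "f1 s = 0"
    by (rule DERIV_local_max[OF D1[OF sS] d(1)]) (use max d in \<open>auto simp: abs_minus_commute\<close>)
  have z2: "f2 s = 0"
  proof -
    have "Ker 2 (Q_form p 2 m \<beta>) \<inter> zero_sum_vecs 2 \<noteq> {\<lambda>r\<in>{1..2}. 0}"
      using sp m unfolding special_def unique_global_maximizer_def by blast
    moreover have "(\<lambda>r\<in>{1..2}. 0) \<in> Ker 2 (Q_form p 2 m \<beta>) \<inter> zero_sum_vecs 2"
      by (auto simp: Ker_def Q_form_def zero_sum_vecs_def vecs_def)
    ultimately obtain t where t: "t \<in> Ker 2 (Q_form p 2 m \<beta>)" "t \<in> zero_sum_vecs 2"
      "t \<noteq> (\<lambda>r\<in>{1..2}. 0)" by blast
    have t2: "t 2 = - t 1" using t(2) unfolding zero_sum_vecs_def atLeastAtMost_1_2 by simp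
    have "t 1 \<noteq> 0"
    proof
      assume "t 1 = 0"
      with t2 have "\<forall>r\<in>{1..2}. t r = 0" unfolding atLeastAtMost_1_2 by simp
      then have "t = (\<lambda>r\<in>{1..2}. 0)"
        using t(2) by (intro extensionalityI[of _ "{1..2}"]) (auto simp: zero_sum_vecs_def vecs_def PiE_def)
      with t(3) show False by simp
    qed
    have "Q_form p 2 m \<beta> t = 4 * f2 s * (t 1)\<^sup>2"
      unfolding Q_form_def atLeastAtMost_1_2 ms f2_def B_def r
      using t2 by (simp add: x_vec_2 algebra_simps)
    moreover have "Q_form p 2 m \<beta> t = 0" using t(1) by (simp add: Ker_def)
    ultimately show ?thesis using \<open>t 1 \<noteq> 0\<close> by simp
  qed
  have z3: "f3 s = 0"
  proof (rule third_derivative_zero_at_local_max[where f = "f_fun p 2 \<beta> h" and ?f1.0 = f1 and ?f2.0 = f2 and ?f3.0 = f3 and s = s and d = d])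
    show "isCont f3 s" using D4[OF sS] DERIV_isCont by blast
  qed (use d D1 D2 D3 z1 z2 max in auto)
  have scale: "\<And>X Y. B / 8 * X + Y / 8 = 0 \<Longrightarrow> B * X = - Y"
    "\<And>X Y. B / 16 * X - Y / 8 = 0 \<Longrightarrow> B * X = 2 * Y"
    by (simp_all add: field_simps)
  have "r = 2 \<and> a = b"
  proof (rule degenerate_point_algebra)
    show "B * (a ^ r + b ^ r) = 1 / a + 1 / b"
      using z2 unfolding f2_def a_def[symmetric] b_def[symmetric] by simp
    show "B * (real r * a ^ (r - 1) - real r * b ^ (r - 1)) = 1 / b\<^sup>2 - 1 / a\<^sup>2"
      using scale(1)[OF z3[unfolded f3_def a_def[symmetric] b_def[symmetric]]] by (simp only: minus_diff_eq)
    show "B * (real r * real (r - 1) * a ^ (r - 2) + real r * real (r - 1) * b ^ (r - 2))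
               = 2 / a ^ 3 + 2 / b ^ 3"
      using scale(2)[OF z4[unfolded f4_def a_def[symmetric] b_def[symmetric]]]
      by (simp only: distrib_left times_divide_eq_right mult_1_right)
  qed (use ab in auto)
  then have s0: "s = 0" and r2: "r = 2" by (auto simp: a_def b_def)
  then show p4: "p = 4" and "m = x_vec 2 0" using r ms by auto
  show "h = 0" using z1 by (simp add: f1_def s0)
  show "\<beta> = 2 / 3" using z2 by (simp add: f2_def s0 r2 B_def p4 power2_eq_square)
qed

text \<open>
  The third magnetization is \<open>1\<close> on the constant configuration \<open>3\<close> and \<open>0\<close> on the constant
  configuration \<open>1\<close>, but the direction has third coordinate \<open>0\<close>.
\<close>

lemma no_fluctuation_if_q_gt_2:
  assumes "q > 2" "N \<ge> 1"
  shows "\<not> is_fluctuation q N m F"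
proof
  assume F: "is_fluctuation q N m F"
  let ?X = "\<lambda>c. \<lambda>i\<in>{1..N}. c"
  have "magnetization N (?X c) 3 = m 3" if "c \<in> {1..q}" for c
  proof -
    have "?X c \<in> configs q N" using that by (auto simp: configs_def)
    moreover have "(3::nat) \<in> {1..q}" using assms by auto
    ultimately have "magnetization N (?X c) 3 - m 3 = real N powr (- 1 / 6) * F (?X c) * u_vec 3"
      using F unfolding is_fluctuation_def by blast
    then show ?thesis by (simp add: u_vec_def)
  qed
  from this[of 3] this[of 1] have "magnetization N (?X 3) 3 = magnetization N (?X 1) 3"
    using assms by simp
  then show False using assms by (simp add: magnetization_def)
qed

section \<open>The drift\<close>

text \<open>
  The factor \<open>(1 - s) exp (2 s + 2 s\<^sup>3 / 3)\<close> is, up to \<open>O(1/N)\<close>, the weight of moving one site from the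
  first to the second colour, and \<open>1 + s\<close> is that of the move back.
\<close>

definition drift :: "real \<Rightarrow> real" where
  "drift s = (1 - s) * exp (2 * s + 2 * s ^ 3 / 3) - (1 + s)"

text \<open>
  The local expansion is extended to \<open>[-1, 1]\<close> by compactness.
\<close>

lemma drift_expansion: "\<exists>K. \<forall>s. \<bar>s\<bar> \<le> 1 \<longrightarrow> \<bar>drift s + 2 / 5 * s ^ 5\<bar> \<le> K * s ^ 6"
proof -
  have "(\<lambda>s. drift s + 2 / 5 * s ^ 5) \<in> O[at 0](\<lambda>s. s ^ 6)"
    unfolding drift_def by real_asymp
  then obtain c where c: "c > 0" "\<forall>\<^sub>F s in at 0. \<bar>drift s + 2 / 5 * s ^ 5\<bar> \<le> c * \<bar>s ^ 6\<bar>"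
    by (elim landau_o.bigE) auto
  then obtain d where d: "d > 0" "\<And>s. s \<noteq> 0 \<Longrightarrow> \<bar>s\<bar> < d \<Longrightarrow> \<bar>drift s + 2 / 5 * s ^ 5\<bar> \<le> c * \<bar>s ^ 6\<bar>"
    unfolding eventually_at dist_real_def by auto
  have "continuous_on {-1..1} (\<lambda>s. drift s + 2 / 5 * s ^ 5)"
    unfolding drift_def by (intro continuous_intros) auto
  then have "compact ((\<lambda>s. drift s + 2 / 5 * s ^ 5) ` {-1..1})"
    by (intro compact_continuous_image) auto
  then obtain b where b: "b > 0" "\<And>s. s \<in> {-1..1} \<Longrightarrow> \<bar>drift s + 2 / 5 * s ^ 5\<bar> \<le> b"
    using compact_imp_bounded bounded_pos by (metis (no_types, lifting) image_eqI real_norm_def)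
  have "\<bar>drift s + 2 / 5 * s ^ 5\<bar> \<le> (c + b / d ^ 6) * s ^ 6" if s: "\<bar>s\<bar> \<le> 1" for s
  proof (cases "\<bar>s\<bar> < d")
    case True
    have "\<bar>drift s + 2 / 5 * s ^ 5\<bar> \<le> c * s ^ 6"
      using d(2)[of s] True by (cases "s = 0") (auto simp: drift_def)
    also have "\<dots> \<le> (c + b / d ^ 6) * s ^ 6"
      using b d by (intro mult_right_mono) auto
    finally show ?thesis .
  next
    case False
    then have "d ^ 6 \<le> \<bar>s\<bar> ^ 6" using d by (intro power_mono) auto
    then have "d ^ 6 \<le> s ^ 6" by simp
    then have "b * 1 \<le> b * (s ^ 6 / d ^ 6)" using b d by (intro mult_left_mono) auto
    then have "b \<le> b / d ^ 6 * s ^ 6" by simp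
    also have "\<dots> \<le> (c + b / d ^ 6) * s ^ 6" using c by (intro mult_right_mono) auto
    finally show ?thesis using b(2)[of s] s by (auto simp: abs_le_iff)
  qed
  then show ?thesis by blast
qed

lemma nonneg_of_deriv_nonneg:
  fixes f f' :: "real \<Rightarrow> real"
  assumes "f 0 = 0" "s \<ge> 0"
    and "\<And>x. 0 \<le> x \<Longrightarrow> x \<le> s \<Longrightarrow> (f has_real_derivative f' x) (at x)"
    and "\<And>x. 0 \<le> x \<Longrightarrow> x \<le> s \<Longrightarrow> f' x \<ge> 0"
  shows "f s \<ge> 0"
proof -
  have "f 0 \<le> f s"
    by (rule DERIV_nonneg_imp_nondecreasing[OF assms(2)]) (use assms in blast)
  then show ?thesis using assms by simp
qed

text \<open>
  With \<open>y = s + s\<^sup>3 / 3\<close>, the right-hand side is \<open>- exp (- y)\<close> times the drift.  Its derivative is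
  \<open>2 s W\<close> with \<open>W = (1 + s\<^sup>2) sinh y - s cosh y\<close>, and \<open>W' \<ge> 2 s\<^sup>2\<close>, because \<open>cosh y \<ge> 1\<close>; integrating
  twice gives the constant \<open>2 \<sqdot> 2/3 \<sqdot> 1/5 = 4/15\<close>.
\<close>

lemma symmetrized_drift_lower:
  fixes s :: real
  assumes s: "0 \<le> s" "s \<le> 1"
  shows "4 / 15 * s ^ 5 \<le> s * (2 * cosh (s + s ^ 3 / 3)) - 2 * sinh (s + s ^ 3 / 3)"
proof -
  let ?y = "\<lambda>s::real. s + s ^ 3 / 3"
  have W: "(1 + x\<^sup>2) * sinh (?y x) - x * cosh (?y x) - 2 / 3 * x ^ 3 \<ge> 0" if x: "0 \<le> x" "x \<le> 1" for x
  proof (rule nonneg_of_deriv_nonneg[where s = x and f = "\<lambda>x. (1 + x\<^sup>2) * sinh (?y x) - x * cosh (?y x) - 2 / 3 * x ^ 3"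
        and f' = "\<lambda>x. x * (1 - x\<^sup>2) * sinh (?y x) + (2 * x\<^sup>2 + x ^ 4) * cosh (?y x) - 2 * x\<^sup>2"])
    fix z assume z: "0 \<le> z" "z \<le> x"
    show "((\<lambda>x. (1 + x\<^sup>2) * sinh (?y x) - x * cosh (?y x) - 2 / 3 * x ^ 3) has_real_derivative
       z * (1 - z\<^sup>2) * sinh (?y z) + (2 * z\<^sup>2 + z ^ 4) * cosh (?y z) - 2 * z\<^sup>2) (at z)"
      by (auto intro!: derivative_eq_intros) (simp add: algebra_simps eval_nat_numeral)
    have "z\<^sup>2 \<le> 1" using z x by (simp add: power_le_one)
    then have 1: "z * (1 - z\<^sup>2) * sinh (?y z) \<ge> 0" using z by simp
    have "2 * z\<^sup>2 * 1 \<le> (2 * z\<^sup>2 + z ^ 4) * cosh (?y z)"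
      by (intro mult_mono cosh_real_ge_1) auto
    with 1 show "z * (1 - z\<^sup>2) * sinh (?y z) + (2 * z\<^sup>2 + z ^ 4) * cosh (?y z) - 2 * z\<^sup>2 \<ge> 0" by simp
  qed (use x in auto)
  have "s * (2 * cosh (?y s)) - 2 * sinh (?y s) - 4 / 15 * s ^ 5 \<ge> 0"
  proof (rule nonneg_of_deriv_nonneg[where s = s and f = "\<lambda>s. s * (2 * cosh (?y s)) - 2 * sinh (?y s) - 4 / 15 * s ^ 5"
        and f' = "\<lambda>s. 2 * s * ((1 + s\<^sup>2) * sinh (?y s) - s * cosh (?y s) - 2 / 3 * s ^ 3)"])
    fix z assume z: "0 \<le> z" "z \<le> s"
    show "((\<lambda>s. s * (2 * cosh (?y s)) - 2 * sinh (?y s) - 4 / 15 * s ^ 5) has_real_derivative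
      2 * z * ((1 + z\<^sup>2) * sinh (?y z) - z * cosh (?y z) - 2 / 3 * z ^ 3)) (at z)"
      by (auto intro!: derivative_eq_intros) (simp add: algebra_simps eval_nat_numeral)
    show "2 * z * ((1 + z\<^sup>2) * sinh (?y z) - z * cosh (?y z) - 2 / 3 * z ^ 3) \<ge> 0"
      using W[of z] z s by simp
  qed (use s in auto)
  then show ?thesis by simp
qed

text \<open>
  The symmetrized drift \<open>V\<close> is odd, so its lower bound on \<open>[0, 1]\<close> controls both signs of \<open>s\<close>.
  Undoing the symmetrization costs a factor \<open>exp y \<ge> exp (- 4/3) \<ge> 1/9\<close>, and \<open>4/15 \<sqdot> 1/9 \<ge> 1/40\<close>.
\<close>

lemma drift_coercive:
  assumes "\<bar>s\<bar> \<le> 1"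
  shows "s * drift s \<le> - (s ^ 6 / 40)"
proof -
  let ?y = "s + s ^ 3 / 3"
  define V where "V = s * (2 * cosh ?y) - 2 * sinh ?y"
  have "drift s = - (V * exp ?y)"
  proof -
    have e: "exp (2 * s + 2 * s ^ 3 / 3) = exp ?y * exp ?y" "exp (- ?y) * exp ?y = 1"
      by (simp_all add: exp_add[symmetric] del: minus_add_distrib)
    have "V = exp ?y * (s - 1) + exp (- ?y) * (s + 1)"
      unfolding V_def cosh_def sinh_def by (simp add: algebra_simps)
    then have "V * exp ?y = exp ?y * exp ?y * (s - 1) + exp (- ?y) * exp ?y * (s + 1)"
      by algebra
    then show ?thesis unfolding drift_def e by (simp add: algebra_simps)
  qed
  then have d: "s * drift s = - (s * V * exp ?y)" by simp
  have sV: "4 / 15 * s ^ 6 \<le> s * V"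
  proof (cases "s \<ge> 0")
    case True
    then have "s * (4 / 15 * s ^ 5) \<le> s * V"
      unfolding V_def using assms by (intro mult_left_mono symmetrized_drift_lower) auto
    then show ?thesis by (simp add: eval_nat_numeral algebra_simps)
  next
    case False
    have y: "- s + (- s) ^ 3 / 3 = - ?y" by simp
    have "(- s) * (4 / 15 * (- s) ^ 5) \<le> (- s) * ((- s) * (2 * cosh (- s + (- s) ^ 3 / 3)) - 2 * sinh (- s + (- s) ^ 3 / 3))"
      using assms False by (intro mult_left_mono symmetrized_drift_lower) auto
    also have "\<dots> = s * V"
      unfolding V_def y cosh_minus sinh_minus by (simp add: algebra_simps)
    finally show ?thesis by (simp add: eval_nat_numeral algebra_simps)
  qed
  have "\<bar>s\<bar> ^ 3 \<le> 1" using assms by (intro power_le_one) auto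
  then have "\<bar>s ^ 3\<bar> \<le> 1" by (simp add: power_abs)
  then have "- (4 / 3) \<le> ?y" using assms by linarith
  then have "exp (- (2 / 3)) * exp (- (2 / 3)) \<le> exp ?y"
    by (simp add: exp_add[symmetric])
  moreover have "1 / 3 \<le> exp (- (2 / 3) :: real)"
    using exp_ge_add_one_self[of "- (2 / 3) :: real"] by simp
  then have "1 / 3 * (1 / 3) \<le> exp (- (2 / 3)) * exp (- (2 / 3) :: real)"
    by (intro mult_mono) auto
  ultimately have "1 / 9 \<le> exp ?y" by simp
  then have "4 / 15 * s ^ 6 * (1 / 9) \<le> s * V * exp ?y"
    using sV by (intro mult_mono order.trans[OF _ sV]) auto
  moreover have "s ^ 6 \<ge> 0" by simp
  ultimately show ?thesis unfolding d by linarith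
qed

section \<open>The Stein equation of the sextic density\<close>

definition sextic_weight :: "real \<Rightarrow> real \<Rightarrow> real" where
  "sextic_weight c x = exp (- (c * x ^ 6))"

text \<open>
  The tail beyond \<open>1\<close> contributes \<open>1 / (3 c)\<close> and the unit interval \<open>2\<close>; the exponential bounds the
  inverse weight on the unit interval.
\<close>

definition stein_const :: "real \<Rightarrow> real" where
  "stein_const c = exp c * (2 + 1 / (3 * c))"

text \<open>
  On \<open>[x, \<infinity>)\<close> with \<open>x \<ge> 1\<close> one has \<open>1 + z \<le> 2 z\<^sup>5 / x\<^sup>4\<close>, and \<open>z\<^sup>5 exp (- c z\<^sup>6)\<close> has an elementary
  antiderivative, so comparing derivatives controls the increments of \<open>\<Psi>\<close>; this also yields
  convergence at infinity and the gain of the factor \<open>x\<^sup>4\<close>.  On \<open>[0, 1]\<close> the crude bound \<open>2 K\<close> on the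
  derivative is enough.
\<close>

lemma antiderivative_tail_bounds:
  fixes \<Psi> \<psi> :: "real \<Rightarrow> real"
  assumes c: "c > 0" and K: "K \<ge> 0"
    and D: "\<And>y. (\<Psi> has_real_derivative \<psi> y) (at y)"
    and bd: "\<And>y. \<bar>\<psi> y\<bar> \<le> K * (1 + \<bar>y\<bar>) * sextic_weight c y"
  obtains L where "(\<lambda>n. \<Psi> (real n)) \<longlonglongrightarrow> L"
    and "\<And>x. x \<ge> 0 \<Longrightarrow> \<bar>\<Psi> x - L\<bar> \<le> K * stein_const c * sextic_weight c x"
    and "\<And>x. x \<ge> 0 \<Longrightarrow> x ^ 4 * \<bar>\<Psi> x - L\<bar> \<le> K * stein_const c * sextic_weight c x"
proof -
  have dominate: "\<bar>\<psi> z\<bar> \<le> 2 * K * z ^ 5 / x ^ 4 * sextic_weight c z" if x: "1 \<le> x" "x \<le> z" for x z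
  proof -
    have "x ^ 4 \<le> z ^ 4" using x by (intro power_mono) auto
    then have "z * x ^ 4 \<le> z * z ^ 4" using x by (intro mult_left_mono) auto
    then have "z \<le> z ^ 5 / x ^ 4" using x by (simp add: field_simps eval_nat_numeral)
    then have "1 + \<bar>z\<bar> \<le> 2 * (z ^ 5 / x ^ 4)" using x by linarith
    then have "K * (1 + \<bar>z\<bar>) * sextic_weight c z \<le> K * (2 * (z ^ 5 / x ^ 4)) * sextic_weight c z"
      using K by (intro mult_right_mono mult_left_mono) (auto simp: sextic_weight_def)
    with bd[of z] show ?thesis by (simp add: mult_ac)
  qed
  \<comment> \<open>The dominating function is an exact derivative.\<close>
  define G where "G = (\<lambda>x z. - (K / (3 * c * x ^ 4)) * sextic_weight c z)"
  have DG: "(G x has_real_derivative 2 * K * z ^ 5 / x ^ 4 * sextic_weight c z) (at z)"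
    if "x \<ge> 1" for x z
    unfolding G_def sextic_weight_def using c that
    by (auto intro!: derivative_eq_intros simp: field_simps)
  have mono: "\<Psi> x + G w x \<le> \<Psi> y + G w y" "\<Psi> y - G w y \<le> \<Psi> x - G w x"
    if "1 \<le> w" "w \<le> x" "x \<le> y" for w x y
  proof -
    show "\<Psi> x + G w x \<le> \<Psi> y + G w y"
    proof (rule DERIV_nonneg_imp_nondecreasing[OF that(3)])
      fix z assume z: "x \<le> z" "z \<le> y"
      show "\<exists>d. ((\<lambda>z. \<Psi> z + G w z) has_real_derivative d) (at z) \<and> d \<ge> 0"
        by (rule exI, rule conjI, rule DERIV_add[OF D DG[OF that(1)]])
          (use dominate[of w z] that z in linarith)
    qed
    have "- (\<Psi> x - G w x) \<le> - (\<Psi> y - G w y)"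
    proof (rule DERIV_nonneg_imp_nondecreasing[OF that(3)])
      fix z assume z: "x \<le> z" "z \<le> y"
      show "\<exists>d. ((\<lambda>z. - (\<Psi> z - G w z)) has_real_derivative d) (at z) \<and> d \<ge> 0"
        by (rule exI, rule conjI, rule DERIV_minus[OF DERIV_diff[OF D DG[OF that(1)]]])
          (use dominate[of w z] that z in linarith)
    qed
    then show "\<Psi> y - G w y \<le> \<Psi> x - G w x" by simp
  qed
  have G_neg: "G x z \<le> 0" for x z
    unfolding G_def sextic_weight_def using c K
    by (simp add: zero_le_even_power)
  have tail: "\<bar>\<Psi> y - \<Psi> x\<bar> \<le> K / (3 * c * x ^ 4) * sextic_weight c x" if "1 \<le> x" "x \<le> y" for x y
    using mono[of x x y] that G_neg[of x y] by (auto simp: G_def)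
  have "incseq (\<lambda>n. \<Psi> (real (Suc n)) + G 1 (real (Suc n)))"
    by (intro incseq_SucI mono) auto
  moreover have "\<Psi> (real (Suc n)) + G 1 (real (Suc n)) \<le> \<Psi> 1 + K / (3 * c) * sextic_weight c 1" for n
    using tail[of 1 "real (Suc n)"] G_neg[of 1 "real (Suc n)"] by auto
  ultimately obtain L where L: "(\<lambda>n. \<Psi> (real (Suc n)) + G 1 (real (Suc n))) \<longlonglongrightarrow> L"
    using incseq_convergent by blast
  have "(\<lambda>n. exp (- (c * real n ^ 6))) \<longlonglongrightarrow> 0" using c by real_asymp
  then have "(\<lambda>n. G 1 (real n)) \<longlonglongrightarrow> - (K / (3 * c * 1 ^ 4)) * 0"
    unfolding G_def sextic_weight_def by (intro tendsto_intros)
  then have "(\<lambda>n. G 1 (real (Suc n))) \<longlonglongrightarrow> 0"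
    using LIMSEQ_Suc by fastforce
  from tendsto_diff[OF L this] have "(\<lambda>n. \<Psi> (real (Suc n))) \<longlonglongrightarrow> L" by simp
  then have lim: "(\<lambda>n. \<Psi> (real n)) \<longlonglongrightarrow> L" by (rule LIMSEQ_imp_Suc)
  have tailL: "\<bar>\<Psi> x - L\<bar> \<le> K / (3 * c * x ^ 4) * sextic_weight c x" if "1 \<le> x" for x
  proof -
    have "(\<lambda>n. \<bar>\<Psi> (real n) - \<Psi> x\<bar>) \<longlonglongrightarrow> \<bar>L - \<Psi> x\<bar>"
      by (intro tendsto_intros lim)
    moreover have "\<bar>\<Psi> (real n) - \<Psi> x\<bar> \<le> K / (3 * c * x ^ 4) * sextic_weight c x"
      if "n \<ge> nat \<lceil>x\<rceil>" for n
      using that \<open>1 \<le> x\<close> by (intro tail) linarith+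
    ultimately have "\<bar>L - \<Psi> x\<bar> \<le> K / (3 * c * x ^ 4) * sextic_weight c x"
      by - (rule LIMSEQ_le_const2[OF _ exI[of _ "nat \<lceil>x\<rceil>"]], auto)
    then show ?thesis by (simp add: abs_minus_commute)
  qed
  have SC: "stein_const c \<ge> 1 / (3 * c)" "stein_const c \<ge> 0"
  proof -
    have "1 * (1 / (3 * c)) \<le> exp c * (2 + 1 / (3 * c))"
      using c by (intro mult_mono) auto
    then show "stein_const c \<ge> 1 / (3 * c)" by (simp add: stein_const_def)
    also have "1 / (3 * c) \<ge> 0" using c by simp
    finally show "stein_const c \<ge> 0" .
  qed
  have main: "\<bar>\<Psi> x - L\<bar> \<le> K * stein_const c * sextic_weight c x \<and>
     x ^ 4 * \<bar>\<Psi> x - L\<bar> \<le> K * stein_const c * sextic_weight c x" if x: "x \<ge> 0" for x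
  proof (cases "x \<ge> 1")
    case True
    then have x4: "x ^ 4 \<ge> 1" by simp
    have "x ^ 4 * \<bar>\<Psi> x - L\<bar> \<le> x ^ 4 * (K / (3 * c * x ^ 4) * sextic_weight c x)"
      using tailL[OF True] by (intro mult_left_mono) auto
    also have "\<dots> = K * (1 / (3 * c)) * sextic_weight c x" using True c by (simp add: field_simps)
    also have "\<dots> \<le> K * stein_const c * sextic_weight c x"
      using SC K by (intro mult_right_mono mult_left_mono) (auto simp: sextic_weight_def)
    finally have 1: "x ^ 4 * \<bar>\<Psi> x - L\<bar> \<le> K * stein_const c * sextic_weight c x" .
    have "1 * \<bar>\<Psi> x - L\<bar> \<le> x ^ 4 * \<bar>\<Psi> x - L\<bar>" using x4 by (intro mult_right_mono) auto
    with 1 show ?thesis by simp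
  next
    case False
    have "\<bar>\<Psi> 1 - \<Psi> x\<bar> \<le> 2 * K * \<bar>1 - x\<bar>"
    proof -
      have "norm (\<Psi> 1 - \<Psi> x) \<le> 2 * K * norm (1 - x)"
      proof (rule field_differentiable_bound[of "{0..1}" \<Psi> \<psi>])
        fix z :: real assume z: "z \<in> {0..1}"
        show "(\<Psi> has_field_derivative \<psi> z) (at z within {0..1})"
          using D by (rule has_field_derivative_at_within)
        have "K * (1 + \<bar>z\<bar>) * sextic_weight c z \<le> K * 2 * 1"
          using z K c by (intro mult_mono) (auto simp: sextic_weight_def)
        then show "norm (\<psi> z) \<le> 2 * K" using bd[of z] by simp
      qed (use x False in auto)
      then show ?thesis by simp
    qed
    also have "\<dots> \<le> 2 * K * 1" using x False K by (intro mult_left_mono) auto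
    finally have 1: "\<bar>\<Psi> 1 - \<Psi> x\<bar> \<le> 2 * K" by simp
    have "K / (3 * c * 1 ^ 4) * sextic_weight c 1 \<le> K / (3 * c * 1 ^ 4) * 1"
      using K c by (intro mult_left_mono) (auto simp: sextic_weight_def)
    with tailL[of 1] have "\<bar>\<Psi> 1 - L\<bar> \<le> K / (3 * c)" by simp
    with 1 have 2: "\<bar>\<Psi> x - L\<bar> \<le> K * (2 + 1 / (3 * c))" by (simp add: algebra_simps)
    have "x ^ 6 \<le> 1" using x False by (intro power_le_one) auto
    then have "c * x ^ 6 \<le> c" using c by simp
    then have "1 \<le> exp c * sextic_weight c x"
      by (simp add: sextic_weight_def exp_add[symmetric])
    then have "K * (2 + 1 / (3 * c)) * 1 \<le> K * (2 + 1 / (3 * c)) * (exp c * sextic_weight c x)"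
      using K c by (intro mult_left_mono) auto
    with 2 have 3: "\<bar>\<Psi> x - L\<bar> \<le> K * stein_const c * sextic_weight c x"
      by (simp add: stein_const_def mult_ac)
    have "x ^ 4 \<le> 1" using x False by (intro power_le_one) auto
    then have "x ^ 4 * \<bar>\<Psi> x - L\<bar> \<le> 1 * \<bar>\<Psi> x - L\<bar>" by (intro mult_right_mono) auto
    with 3 show ?thesis by simp
  qed
  show thesis by (rule that[OF lim]) (use main in auto)
qed

text \<open>
  The solution is \<open>exp (c x\<^sup>6)\<close> times the integral of \<open>\<phi> exp (- c y\<^sup>6)\<close> over \<open>(-\<infinity>, x]\<close>, which is minus
  the integral over \<open>[x, \<infinity>)\<close> by the zero-mean hypothesis.  Both tails are therefore small, the left
  one by reflection, and the weight \<open>exp (c x\<^sup>6)\<close> is absorbed.  The bound on \<open>x\<^sup>4 f x\<close> makes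
  \<open>x\<^sup>5 f x\<close>, and hence \<open>f'\<close>, of linear growth.
\<close>

lemma sextic_stein_solution:
  fixes \<phi> :: "real \<Rightarrow> real"
  assumes c: "c > 0" and K: "K \<ge> 0"
    and cont: "continuous_on UNIV \<phi>" and bd: "\<And>y. \<bar>\<phi> y\<bar> \<le> K * (1 + \<bar>y\<bar>)"
    and int: "integrable lborel (\<lambda>y. \<phi> y * sextic_weight c y)"
    and zero: "(LINT y|lborel. \<phi> y * sextic_weight c y) = 0"
  obtains f where "\<And>x. (f has_real_derivative 6 * c * x ^ 5 * f x + \<phi> x) (at x)"
    and "\<And>x. \<bar>f x\<bar> \<le> K * stein_const c"
    and "\<And>x. x ^ 4 * \<bar>f x\<bar> \<le> K * stein_const c"
proof -
  define \<psi> where "\<psi> = (\<lambda>y. \<phi> y * sextic_weight c y)"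
  have cont_\<psi>: "isCont \<psi> x" for x
    using cont unfolding \<psi>_def sextic_weight_def
    by (intro continuous_intros) (simp add: continuous_on_eq_continuous_at)
  have "\<exists>F. \<forall>x. -\<infinity> < ereal x \<longrightarrow> ereal x < \<infinity> \<longrightarrow> (F has_vector_derivative \<psi> x) (at x)"
    by (rule einterval_antiderivative) (use cont_\<psi> in auto)
  then obtain \<Psi> where D: "\<And>x. (\<Psi> has_real_derivative \<psi> x) (at x)"
    by (auto simp: has_real_derivative_iff_has_vector_derivative)
  have bd\<psi>: "\<bar>\<psi> y\<bar> \<le> K * (1 + \<bar>y\<bar>) * sextic_weight c y" for y
    unfolding \<psi>_def using bd[of y] by (simp add: abs_mult sextic_weight_def)
  have bd\<psi>': "\<bar>\<psi> (- y)\<bar> \<le> K * (1 + \<bar>y\<bar>) * sextic_weight c y" for y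
    using bd\<psi>[of "- y"] by (simp add: sextic_weight_def)
  have D': "((\<lambda>y. - \<Psi> (- y)) has_real_derivative \<psi> (- y)) (at y)" for y
    by (rule derivative_eq_intros DERIV_chain2[OF D] refl)+ simp
  obtain L where L: "(\<lambda>n. \<Psi> (real n)) \<longlonglongrightarrow> L"
      "\<And>x. x \<ge> 0 \<Longrightarrow> \<bar>\<Psi> x - L\<bar> \<le> K * stein_const c * sextic_weight c x"
      "\<And>x. x \<ge> 0 \<Longrightarrow> x ^ 4 * \<bar>\<Psi> x - L\<bar> \<le> K * stein_const c * sextic_weight c x"
    using antiderivative_tail_bounds[OF c K D bd\<psi>] by metis
  obtain L' where L': "(\<lambda>n. - \<Psi> (- real n)) \<longlonglongrightarrow> L'"
      "\<And>x. x \<ge> 0 \<Longrightarrow> \<bar>- \<Psi> (- x) - L'\<bar> \<le> K * stein_const c * sextic_weight c x"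
      "\<And>x. x \<ge> 0 \<Longrightarrow> x ^ 4 * \<bar>- \<Psi> (- x) - L'\<bar> \<le> K * stein_const c * sextic_weight c x"
    using antiderivative_tail_bounds[OF c K D' bd\<psi>'] by metis
  have "L + L' = 0"
  proof -
    have "(\<lambda>n. LINT y|lborel. indicator {- real n..real n} y * \<psi> y) \<longlonglongrightarrow> (LINT y|lborel. \<psi> y)"
    proof (rule integral_dominated_convergence)
      show "integrable lborel (\<lambda>y. norm (\<psi> y))" using int by (simp add: \<psi>_def)
      show "AE y in lborel. (\<lambda>n. indicator {- real n..real n} y * \<psi> y) \<longlonglongrightarrow> \<psi> y"
      proof (rule AE_I2)
        fix y :: real
        have "indicator {- real n..real n} y * \<psi> y = \<psi> y" if "n \<ge> nat \<lceil>\<bar>y\<bar>\<rceil>" for n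
        proof -
          have "\<bar>y\<bar> \<le> real n" using that by linarith
          then show ?thesis by (simp add: indicator_def abs_le_iff)
        qed
        then show "(\<lambda>n. indicator {- real n..real n} y * \<psi> y) \<longlonglongrightarrow> \<psi> y"
          by (intro tendsto_eventually eventually_sequentiallyI)
      qed
      show "AE y in lborel. norm (indicator {- real n..real n} y * \<psi> y) \<le> norm (\<psi> y)" for n
        by (auto simp: indicator_def)
    qed (use int in \<open>auto simp: \<psi>_def[symmetric]\<close>)
    moreover have "(LINT y|lborel. indicator {- real n..real n} y * \<psi> y) = \<Psi> (real n) - \<Psi> (- real n)" for n
      using integral_FTC_Icc_real[of "- real n" "real n" \<Psi> \<psi>] D cont_\<psi> by (simp add: mult.commute)
    ultimately have "(\<lambda>n. \<Psi> (real n) + - \<Psi> (- real n)) \<longlonglongrightarrow> 0"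
      using zero by (simp add: \<psi>_def)
    with tendsto_add[OF L(1) L'(1)] show ?thesis
      using LIMSEQ_unique by blast
  qed
  then have L'_eq: "L' = - L" by simp
  define f where "f = (\<lambda>x. exp (c * x ^ 6) * (\<Psi> x - L))"
  have both: "\<bar>\<Psi> x - L\<bar> \<le> K * stein_const c * sextic_weight c x"
     "x ^ 4 * \<bar>\<Psi> x - L\<bar> \<le> K * stein_const c * sextic_weight c x" for x
  proof -
    have 1: "\<bar>\<Psi> x - L\<bar> \<le> K * stein_const c * sextic_weight c x \<and>
       x ^ 4 * \<bar>\<Psi> x - L\<bar> \<le> K * stein_const c * sextic_weight c x"
    proof (cases "x \<ge> 0")
      case False
      then show ?thesis
        using L'(2,3)[of "- x"] by (simp add: L'_eq sextic_weight_def abs_minus_commute)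
    qed (use L in auto)
    then show "\<bar>\<Psi> x - L\<bar> \<le> K * stein_const c * sextic_weight c x"
     "x ^ 4 * \<bar>\<Psi> x - L\<bar> \<le> K * stein_const c * sextic_weight c x" by auto
  qed
  have cancel: "exp (c * x ^ 6) * sextic_weight c x = 1" for x
    by (simp add: sextic_weight_def exp_add[symmetric])
  show thesis
  proof
    fix x
    have "(f has_real_derivative exp (c * x ^ 6) * (c * (6 * x ^ 5)) * (\<Psi> x - L) + exp (c * x ^ 6) * \<psi> x) (at x)"
      unfolding f_def by (auto intro!: derivative_eq_intros D)
    also have "exp (c * x ^ 6) * (c * (6 * x ^ 5)) * (\<Psi> x - L) + exp (c * x ^ 6) * \<psi> x =
        6 * c * x ^ 5 * f x + \<phi> x"
      using cancel[of x] by (simp add: f_def \<psi>_def algebra_simps)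
    finally show "(f has_real_derivative 6 * c * x ^ 5 * f x + \<phi> x) (at x)" .
    have "exp (c * x ^ 6) * \<bar>\<Psi> x - L\<bar> \<le> exp (c * x ^ 6) * (K * stein_const c * sextic_weight c x)"
      by (intro mult_left_mono both) auto
    also have "\<dots> = K * stein_const c" using cancel[of x] by (simp add: algebra_simps)
    finally show "\<bar>f x\<bar> \<le> K * stein_const c" by (simp add: f_def abs_mult)
    have "exp (c * x ^ 6) * (x ^ 4 * \<bar>\<Psi> x - L\<bar>) \<le> exp (c * x ^ 6) * (K * stein_const c * sextic_weight c x)"
      by (intro mult_left_mono both) auto
    also have "\<dots> = K * stein_const c" using cancel[of x] by (simp add: algebra_simps)
    finally show "x ^ 4 * \<bar>f x\<bar> \<le> K * stein_const c" by (simp add: f_def abs_mult mult_ac)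
  qed
qed

section \<open>The sextic law\<close>

lemma sextic_weight_pos: "sextic_weight c x > 0"
  by (simp add: sextic_weight_def)

lemma sextic_weight_antimono: "c \<le> c' \<Longrightarrow> sextic_weight c' x \<le> sextic_weight c x"
  by (simp add: sextic_weight_def mult_right_mono)

lemma sextic_weight_measurable [measurable]: "sextic_weight c \<in> borel_measurable borel"
  unfolding sextic_weight_def[abs_def] by measurable

text \<open>
  Domination by a Gaussian reduces integrability to the moments of the normal distribution.
\<close>

lemma sextic_weight_gaussian_bound:
  assumes c: "c > 0"
  obtains D where "D > 0" "\<And>x. sextic_weight c x \<le> D * std_normal_density x"
proof -
  define U where "U = 1 + 1 / c"
  have U: "U \<ge> 1" "c * U \<ge> 1" using c by (auto simp: U_def field_simps)
  have le: "x\<^sup>2 / 2 \<le> c * x ^ 6 + U" for x :: real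
  proof (cases "x\<^sup>2 \<le> U")
    case True
    then have "x\<^sup>2 / 2 \<le> U" using U by simp
    moreover have "c * x ^ 6 \<ge> 0" using c by simp
    ultimately show ?thesis by simp
  next
    case False
    then have "1 \<le> x\<^sup>2" "c * U \<le> c * x\<^sup>2" using U c by auto
    then have "1 * 1 * x\<^sup>2 \<le> (c * x\<^sup>2) * x\<^sup>2 * x\<^sup>2" using U by (intro mult_mono) auto
    also have "\<dots> = c * x ^ 6" by (simp add: eval_nat_numeral)
    finally have 1: "x\<^sup>2 \<le> c * x ^ 6" by simp
    have "x\<^sup>2 \<ge> 0" by simp
    with 1 show ?thesis using U(1) by linarith
  qed
  show thesis
  proof
    show "exp U * sqrt (2 * pi) > 0" by simp
    fix x
    have "sextic_weight c x \<le> exp U * exp (- (x\<^sup>2 / 2))"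
      using le[of x] by (simp add: sextic_weight_def exp_add[symmetric])
    also have "\<dots> = exp U * sqrt (2 * pi) * std_normal_density x"
      by (simp add: std_normal_density_def)
    finally show "sextic_weight c x \<le> exp U * sqrt (2 * pi) * std_normal_density x" .
  qed
qed

lemma integrable_sextic_weight_times:
  assumes c: "c > 0" and g: "g \<in> borel_measurable borel" and bd: "\<And>x. \<bar>g x\<bar> \<le> A * (1 + \<bar>x\<bar>)"
  shows "integrable lborel (\<lambda>x. g x * sextic_weight c x)"
proof -
  obtain D where D: "D > 0" "\<And>x. sextic_weight c x \<le> D * std_normal_density x"
    using sextic_weight_gaussian_bound[OF c] by blast
  show ?thesis
  proof (rule Bochner_Integration.integrable_bound)
    show "integrable lborel (\<lambda>x. A * D * (std_normal_density x * \<bar>x\<bar> ^ 0 + std_normal_density x * \<bar>x\<bar> ^ 1))"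
      by (intro integrable_mult_right Bochner_Integration.integrable_add integrable_std_normal_moment_abs)
    show "AE x in lborel. norm (g x * sextic_weight c x) \<le>
        norm (A * D * (std_normal_density x * \<bar>x\<bar> ^ 0 + std_normal_density x * \<bar>x\<bar> ^ 1))"
    proof (rule AE_I2)
      fix x :: real
      have "\<bar>g x * sextic_weight c x\<bar> = \<bar>g x\<bar> * sextic_weight c x"
        using sextic_weight_pos[of c x] by (simp add: abs_mult)
      also have "\<dots> \<le> (A * (1 + \<bar>x\<bar>)) * (D * std_normal_density x)"
        using sextic_weight_pos[of c x] bd[of x] D
        by (intro mult_mono) (auto intro: order.trans[OF abs_ge_zero])
      also have "\<dots> = A * D * (std_normal_density x * \<bar>x\<bar> ^ 0 + std_normal_density x * \<bar>x\<bar> ^ 1)"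
        by (simp add: algebra_simps)
      finally show "norm (g x * sextic_weight c x) \<le>
        norm (A * D * (std_normal_density x * \<bar>x\<bar> ^ 0 + std_normal_density x * \<bar>x\<bar> ^ 1))" by simp
    qed
  qed (use g in measurable)
qed

lemma integrable_sextic_weight: "c > 0 \<Longrightarrow> integrable lborel (sextic_weight c)"
  using integrable_sextic_weight_times[of c "\<lambda>_. 1" 1] by simp

definition sextic_mass :: "real \<Rightarrow> real" where
  "sextic_mass c = (LINT x|lborel. sextic_weight c x)"

lemma sextic_mass_pos:
  assumes "c > 0"
  shows "sextic_mass c > 0"
proof -
  have "sextic_mass c \<noteq> 0"
  proof
    assume "sextic_mass c = 0"
    then have "AE x in lborel. sextic_weight c x = 0"
      unfolding sextic_mass_def
      by (subst (asm) integral_nonneg_eq_0_iff_AE)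
        (use assms in \<open>auto simp: integrable_sextic_weight less_imp_le[OF sextic_weight_pos]\<close>)
    then have "AE x::real in lborel. False"
      by eventually_elim (use sextic_weight_pos less_irrefl in metis)
    then show False by (simp add: eventually_False ae_filter_eq_bot_iff)
  qed
  moreover have "sextic_mass c \<ge> 0"
    unfolding sextic_mass_def by (intro integral_nonneg_AE) (simp add: less_imp_le[OF sextic_weight_pos])
  ultimately show ?thesis by simp
qed

lemma sextic_mass_antimono:
  assumes "0 < c" "c \<le> c'"
  shows "sextic_mass c' \<le> sextic_mass c"
  unfolding sextic_mass_def using assms
  by (intro integral_mono integrable_sextic_weight sextic_weight_antimono) auto

definition sextic_moment :: "real \<Rightarrow> real" where
  "sextic_moment c = (LINT x|lborel. \<bar>x\<bar> * sextic_weight c x)"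

lemma sextic_moment_antimono:
  assumes "0 < c" "c \<le> c'"
  shows "sextic_moment c' \<le> sextic_moment c"
  unfolding sextic_moment_def using assms
  by (intro integral_mono integrable_sextic_weight_times[where A = 1] mult_left_mono sextic_weight_antimono) auto

lemma sextic_moment_nonneg: "sextic_moment c \<ge> 0"
  unfolding sextic_moment_def by (intro integral_nonneg_AE) (simp add: less_imp_le[OF sextic_weight_pos])

lemma sextic_law_eq:
  assumes "a > 0"
  shows "sextic_law a = density lborel (\<lambda>x. ennreal (sextic_weight (1 / (6 * a)) x / sextic_mass (1 / (6 * a))))"
  unfolding sextic_law_def sextic_mass_def sextic_weight_def by simp

lemma integral_sextic_law:
  assumes a: "a > 0" and c: "c = 1 / (6 * a)" and g [measurable]: "g \<in> borel_measurable borel"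
  shows "(LINT x|sextic_law a. g x) = (LINT x|lborel. g x * sextic_weight c x) / sextic_mass c"
proof -
  have cp: "c > 0" using a c by simp
  have "(LINT x|sextic_law a. g x) = (LINT x|lborel. (sextic_weight c x / sextic_mass c) *\<^sub>R g x)"
    unfolding sextic_law_eq[OF a] c[symmetric]
    by (rule integral_density) (use sextic_mass_pos[OF cp] sextic_weight_pos in \<open>auto intro!: AE_I2 less_imp_le divide_pos_pos\<close>)
  also have "\<dots> = (LINT x|lborel. (g x * sextic_weight c x) / sextic_mass c)"
    by (simp add: mult.commute)
  finally show ?thesis by simp
qed

lemma integrable_sextic_law:
  assumes a: "a > 0" and g [measurable]: "g \<in> borel_measurable borel"
    and bd: "\<And>x. \<bar>g x\<bar> \<le> A * (1 + \<bar>x\<bar>)"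
  shows "integrable (sextic_law a) g"
proof -
  define c where c: "c = 1 / (6 * a)"
  have cp: "c > 0" using a c by simp
  have "integrable lborel (\<lambda>x. (sextic_weight c x / sextic_mass c) *\<^sub>R g x)"
    using integrable_divide[OF integrable_sextic_weight_times[OF cp g bd], of "sextic_mass c"]
    by (simp add: mult.commute)
  then show ?thesis
    unfolding sextic_law_eq[OF a] c[symmetric]
    by (subst integrable_density) (use sextic_mass_pos[OF cp] sextic_weight_pos in \<open>auto intro!: AE_I2 less_imp_le divide_pos_pos\<close>)
qed

lemma prob_space_sextic_law:
  assumes a: "a > 0"
  shows "prob_space (sextic_law a)"
proof
  define c where c: "c = 1 / (6 * a)"
  have cp: "c > 0" using a c by simp
  have "emeasure (sextic_law a) (space (sextic_law a)) =
     (\<integral>\<^sup>+ x. ennreal (sextic_weight c x / sextic_mass c) \<partial>lborel)"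
    unfolding sextic_law_eq[OF a] c[symmetric] by (subst emeasure_density) auto
  also have "\<dots> = ennreal (LINT x|lborel. sextic_weight c x / sextic_mass c)"
    by (rule nn_integral_eq_integral)
      (use cp sextic_mass_pos[OF cp] in \<open>auto intro!: AE_I2 less_imp_le[OF divide_pos_pos] sextic_weight_pos integrable_sextic_weight\<close>)
  also have "(LINT x|lborel. sextic_weight c x / sextic_mass c) = 1"
    using sextic_mass_pos[OF cp] by (simp add: sextic_mass_def[symmetric])
  finally show "emeasure (sextic_law a) (space (sextic_law a)) = 1" by simp
qed

lemma sets_sextic_law [simp]: "sets (sextic_law a) = sets borel" "space (sextic_law a) = UNIV"
  by (simp_all add: sextic_law_def)

text \<open>
  The density of the law is at most its value at \<open>0\<close>.
\<close>

lemma sextic_law_interval: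
  assumes a: "a > 0" and c: "c = 1 / (6 * a)" and e: "e \<ge> 0"
  shows "measure (sextic_law a) {t<..t + e} \<le> e / sextic_mass c"
proof -
  have cp: "c > 0" using a c by simp
  have "emeasure (sextic_law a) {t<..t + e} =
     (\<integral>\<^sup>+ x. ennreal (sextic_weight c x / sextic_mass c) * indicator {t<..t + e} x \<partial>lborel)"
    unfolding sextic_law_eq[OF a] c[symmetric] by (subst emeasure_density) auto
  also have "\<dots> \<le> (\<integral>\<^sup>+ x. ennreal (1 / sextic_mass c) * indicator {t<..t + e} x \<partial>lborel)"
    using cp sextic_mass_pos[OF cp]
    by (intro nn_integral_mono mult_right_mono ennreal_leI divide_right_mono)
      (auto simp: sextic_weight_def)
  also have "\<dots> = ennreal (1 / sextic_mass c) * emeasure lborel {t<..t + e}"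
    by (rule nn_integral_cmult_indicator) auto
  also have "\<dots> = ennreal (e / sextic_mass c)"
    using e sextic_mass_pos[OF cp] by (simp add: ennreal_mult[symmetric] del: ennreal_mult'')
  finally show ?thesis
    using e sextic_mass_pos[OF cp] by (simp add: measure_def enn2real_leI)
qed

section \<open>Recolouring a site\<close>

definition cfg_weight :: "nat \<Rightarrow> (nat \<Rightarrow> nat) \<Rightarrow> real" where
  "cfg_weight N X = potts_weight 4 2 (2 / 3) 0 N X"

definition eps :: "nat \<Rightarrow> real" where
  "eps N = real N powr (- 1 / 6)"

definition fluct :: "nat \<Rightarrow> (nat \<Rightarrow> nat) \<Rightarrow> real" where
  "fluct N X = (magnetization N X 2 - 1 / 2) / eps N"

text \<open>
  The expectation of \<open>\<phi> F\<close> under the model, as a quotient of finite sums.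
\<close>

definition gibbs_mean :: "nat \<Rightarrow> (real \<Rightarrow> real) \<Rightarrow> real" where
  "gibbs_mean N \<phi> = (\<Sum>X\<in>configs 2 N. cfg_weight N X * \<phi> (fluct N X)) / (\<Sum>X\<in>configs 2 N. cfg_weight N X)"

lemma finite_configs [simp]: "finite (configs q N)"
  unfolding configs_def by (intro finite_PiE) auto

lemma configs_2_const: "(\<lambda>i\<in>{1..N}. 2) \<in> configs 2 N"
  by (auto simp: configs_def)

lemma cfg_weight_pos: "cfg_weight N X > 0"
  by (simp add: cfg_weight_def potts_weight_def)

lemma sum_cfg_weight_pos: "(\<Sum>X\<in>configs 2 N. cfg_weight N X) > 0"
  by (rule sum_pos) (use configs_2_const cfg_weight_pos in \<open>auto\<close>)

lemma integral_potts:
  "(LINT X|potts 4 2 (2 / 3) 0 N. G X) =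
     (\<Sum>X\<in>configs 2 N. cfg_weight N X * G X) / (\<Sum>X\<in>configs 2 N. cfg_weight N X)"
proof -
  have Z: "real 2 ^ N * potts_Z 4 2 (2 / 3) 0 N = (\<Sum>X\<in>configs 2 N. cfg_weight N X)"
    by (simp add: potts_Z_def cfg_weight_def)
  have "(LINT X|potts 4 2 (2 / 3) 0 N. G X) =
     (\<Sum>X\<in>configs 2 N. (1 / (\<Sum>X\<in>configs 2 N. cfg_weight N X) * cfg_weight N X) * G X)"
    unfolding potts_def Z cfg_weight_def[symmetric]
    using sum_cfg_weight_pos[of N] cfg_weight_pos
    by (subst lebesgue_integral_point_measure_finite) (auto intro!: divide_nonneg_pos less_imp_le)
  also have "\<dots> = (\<Sum>X\<in>configs 2 N. cfg_weight N X * G X) / (\<Sum>X\<in>configs 2 N. cfg_weight N X)"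
    by (simp add: sum_divide_distrib)
  finally show ?thesis .
qed

lemma measure_potts:
  "measure (potts 4 2 (2 / 3) 0 N) {X \<in> space (potts 4 2 (2 / 3) 0 N). fluct N X \<le> t} =
     gibbs_mean N (indicator {..t})"
proof -
  let ?P = "potts 4 2 (2 / 3) 0 N"
  let ?A = "{X \<in> space ?P. fluct N X \<le> t}"
  have A: "?A \<in> sets ?P" unfolding potts_def by (auto simp: sets_point_measure space_point_measure)
  have sp: "space ?P = configs 2 N" by (simp add: potts_def space_point_measure)
  have "measure ?P ?A = (LINT X|?P. indicator ?A X)" using A by simp
  also have "\<dots> = (\<Sum>X\<in>configs 2 N. cfg_weight N X * indicator ?A X) / (\<Sum>X\<in>configs 2 N. cfg_weight N X)"
    by (rule integral_potts)
  also have "(\<Sum>X\<in>configs 2 N. cfg_weight N X * indicator ?A X)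
      = (\<Sum>X\<in>configs 2 N. cfg_weight N X * indicator {..t} (fluct N X))"
    by (intro sum.cong) (auto simp: indicator_def sp)
  finally show ?thesis by (simp add: gibbs_mean_def)
qed

lemma eps_bounds: "N \<ge> 1 \<Longrightarrow> 0 < eps N" "N \<ge> 1 \<Longrightarrow> eps N \<le> 1"
  by (auto simp: eps_def powr_minus_divide divide_le_eq ge_one_powr_ge_zero)

lemma eps_power6: "N \<ge> 1 \<Longrightarrow> eps N ^ 6 = 1 / real N"
  unfolding eps_def by (subst powr_power) (auto simp: powr_minus_divide)

definition twos :: "nat \<Rightarrow> (nat \<Rightarrow> nat) \<Rightarrow> real" where
  "twos N X = (\<Sum>i\<in>{1..N}. of_bool (X i = 2))"

text \<open>
  Counting pairs of a configuration and a site of colour \<open>2\<close>: recolouring that site to \<open>1\<close> is a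
  bijection onto the pairs of a configuration and a site of colour \<open>1\<close>, and lowers the count by one.
\<close>

lemma flip_identity:
  fixes u :: "real \<Rightarrow> real"
  shows "(\<Sum>X\<in>configs 2 N. twos N X * u (twos N X)) = (\<Sum>X\<in>configs 2 N. (real N - twos N X) * u (twos N X + 1))"
proof -
  let ?C = "configs 2 N"
  have vals: "X i = 1 \<or> X i = 2" if "X \<in> ?C" "i \<in> {1..N}" for X i
  proof -
    have "X i \<in> {1..2}" using that by (auto simp: configs_def)
    then show ?thesis by auto
  qed
  have upd: "X(i := v) \<in> ?C" if "X \<in> ?C" "i \<in> {1..N}" "v = 1 \<or> v = 2" for X i and v :: nat
    using that by (auto simp: configs_def PiE_def Pi_def extensional_def)
  have twos_upd: "twos N (X(i := 2)) = twos N X + 1" if "i \<in> {1..N}" "X i = 1" for X i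
  proof -
    have "twos N (X(i := 2)) = (\<Sum>j\<in>{1..N}. of_bool (X j = 2) + of_bool (j = i))"
      unfolding twos_def using that by (intro sum.cong) auto
    also have "\<dots> = twos N X + 1"
      using that by (simp add: sum.distrib twos_def of_bool_def sum.delta)
    finally show ?thesis .
  qed
  have "(\<Sum>X\<in>?C. twos N X * u (twos N X)) = (\<Sum>X\<in>?C. \<Sum>i\<in>{1..N}. of_bool (X i = 2) * u (twos N X))"
    unfolding twos_def by (simp add: sum_distrib_right)
  also have "\<dots> = (\<Sum>i\<in>{1..N}. \<Sum>X\<in>?C. of_bool (X i = 2) * u (twos N X))"
    by (rule sum.swap)
  also have "\<dots> = (\<Sum>i\<in>{1..N}. \<Sum>X\<in>?C. of_bool (X i = 1) * u (twos N X + 1))"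
  proof (rule sum.cong[OF refl])
    fix i assume i: "i \<in> {1..N}"
    have flip_back: "twos N X = twos N (X(i := 1)) + 1" if "X i = 2" for X
      using twos_upd[OF i, of "X(i := 1)"] that by (simp add: fun_upd_idem)
    have "(\<Sum>X\<in>?C. of_bool (X i = 2) * u (twos N X)) = (\<Sum>X\<in>{X \<in> ?C. X i = 2}. u (twos N X))"
      by (intro sum.mono_neutral_cong_right) auto
    also have "\<dots> = (\<Sum>X\<in>{X \<in> ?C. X i = 1}. u (twos N X + 1))"
      by (rule sum.reindex_bij_witness[where i = "\<lambda>X. X(i := 2)" and j = "\<lambda>X. X(i := 1)"])
        (use i flip_back upd in \<open>auto simp: fun_upd_idem\<close>)
    also have "\<dots> = (\<Sum>X\<in>?C. of_bool (X i = 1) * u (twos N X + 1))"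
      by (intro sum.mono_neutral_cong_left) auto
    finally show "(\<Sum>X\<in>?C. of_bool (X i = 2) * u (twos N X)) = (\<Sum>X\<in>?C. of_bool (X i = 1) * u (twos N X + 1))" .
  qed
  also have "\<dots> = (\<Sum>X\<in>?C. \<Sum>i\<in>{1..N}. of_bool (X i = 1) * u (twos N X + 1))"
    by (rule sum.swap)
  also have "\<dots> = (\<Sum>X\<in>?C. (real N - twos N X) * u (twos N X + 1))"
  proof (rule sum.cong[OF refl])
    fix X assume X: "X \<in> ?C"
    have "(\<Sum>i\<in>{1..N}. of_bool (X i = 1)) = (\<Sum>i\<in>{1..N}. 1 - (of_bool (X i = 2) :: real))"
      using vals[OF X] by (intro sum.cong) auto
    then have "(\<Sum>i\<in>{1..N}. of_bool (X i = 1)) = real N - twos N X"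
      by (simp add: sum_subtractf twos_def)
    then show "(\<Sum>i\<in>{1..N}. of_bool (X i = 1) * u (twos N X + 1)) = (real N - twos N X) * u (twos N X + 1)"
      by (simp add: sum_distrib_right[symmetric])
  qed
  finally show ?thesis .
qed

lemma magnetization_2: "magnetization N X 2 = twos N X / real N"
  by (simp add: magnetization_def twos_def)

lemma magnetization_1:
  assumes "N \<ge> 1" "X \<in> configs 2 N"
  shows "magnetization N X 1 = 1 - magnetization N X 2"
proof -
  have "X i = 1 \<or> X i = 2" if "i \<in> {1..N}" for i
  proof -
    have "X i \<in> {1..2}" using that assms by (auto simp: configs_def)
    then show ?thesis by auto
  qed
  then have "(\<Sum>i\<in>{1..N}. of_bool (X i = 1)) = (\<Sum>i\<in>{1..N}. 1 - (of_bool (X i = 2) :: real))"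
    by (intro sum.cong) auto
  then show ?thesis using assms by (simp add: magnetization_def sum_subtractf field_simps)
qed

lemma twos_bounds: "0 \<le> twos N X" "twos N X \<le> real N"
proof -
  show "0 \<le> twos N X" unfolding twos_def by (intro sum_nonneg) auto
  have "twos N X \<le> (\<Sum>i\<in>{1..N}. 1)" unfolding twos_def by (intro sum_mono) auto
  then show "twos N X \<le> real N" by simp
qed

lemma fluct_range:
  assumes "N \<ge> 1"
  shows "\<bar>2 * eps N * fluct N X\<bar> \<le> 1"
proof -
  have "2 * eps N * fluct N X = 2 * (twos N X / real N) - 1"
    using eps_bounds[OF assms] by (simp add: fluct_def magnetization_2 field_simps)
  moreover have "0 \<le> twos N X / real N" "twos N X / real N \<le> 1"
    using twos_bounds[of N X] assms by auto
  ultimately show ?thesis by linarith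
qed

text \<open>
  The change of the energy \<open>N (1 + 6 s\<^sup>2 + s\<^sup>4) / 12\<close> when one site changes from colour \<open>1\<close> to
  colour \<open>2\<close>, that is, when \<open>s\<close> grows by \<open>2 / N\<close>; here \<open>e\<^sup>6 = 1 / N\<close>.
\<close>

definition energy_step :: "real \<Rightarrow> real \<Rightarrow> real" where
  "energy_step e s = 2 * s + 2 * s ^ 3 / 3 + e ^ 6 * (2 + 2 * s\<^sup>2 + 8 / 3 * s * e ^ 6 + 4 / 3 * e ^ 12)"

text \<open>
  This is \<open>flip_identity\<close> for the Gibbs weight times \<open>g\<close>, multiplied by \<open>2 / N\<close>: the fractions of the
  two colours are \<open>(1 - s) / 2\<close> and \<open>(1 + s) / 2\<close> with \<open>s = 2 e x\<close>, and one recoloured site moves \<open>x\<close>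
  by \<open>e\<^sup>5\<close>.
\<close>

lemma gibbs_mean_flip:
  assumes N: "N \<ge> 1"
  defines "e \<equiv> eps N"
  shows "gibbs_mean N (\<lambda>x. (1 - 2 * e * x) * exp (energy_step e (2 * e * x)) * g (x + e ^ 5)) =
         gibbs_mean N (\<lambda>x. (1 + 2 * e * x) * g x)"
proof -
  have e: "e > 0" "e ^ 6 = 1 / real N" using eps_bounds[OF N] eps_power6[OF N] by (auto simp: e_def)
  define E where "E = (\<lambda>k. 2 / 3 * real N * ((k / real N) ^ 4 + (1 - k / real N) ^ 4))"
  define pos where "pos = (\<lambda>k. (k / real N - 1 / 2) / e)"
  have w: "cfg_weight N X = exp (E (twos N X))" if "X \<in> configs 2 N" for X
  proof -
    have "magnetization N X 1 = 1 - twos N X / real N"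
      using magnetization_1[OF N that] by (simp add: magnetization_2)
    then have "(\<Sum>r\<in>{1, 2}. magnetization N X r ^ 4) = (twos N X / real N) ^ 4 + (1 - twos N X / real N) ^ 4"
      by (simp add: magnetization_2)
    then show ?thesis
      unfolding cfg_weight_def potts_weight_def E_def atLeastAtMost_1_2 by simp
  qed
  have fl: "fluct N X = pos (twos N X)" for X
    by (simp add: fluct_def pos_def magnetization_2 e_def)
  have k: "k = real N / 2 * (1 + 2 * e * pos k)" for k
    using e N by (simp add: pos_def field_simps)
  have pos1: "pos (k + 1) = pos k + e ^ 5" for k
  proof -
    have "pos (k + 1) = pos k + (1 / real N) / e"
      unfolding pos_def by (simp add: add_divide_distrib diff_divide_distrib)
    also have "(1 / real N) / e = e ^ 5" using e by (simp add: e(2)[symmetric] eval_nat_numeral)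
    finally show ?thesis .
  qed
  have E1: "E (k + 1) = E k + energy_step e (2 * e * pos k)" for k
  proof -
    define s where "s = 2 * e * pos k"
    define n where "n = 1 / real N"
    have n: "n \<noteq> 0" "real N * n = 1" using N by (auto simp: n_def)
    have kN: "k / real N = (1 + s) / 2" using k[of k] N unfolding s_def[symmetric] by (simp add: field_simps)
    have kN1: "(k + 1) / real N = (1 + s) / 2 + n" using kN by (simp add: add_divide_distrib n_def)
    have "e ^ 12 = (e ^ 6)\<^sup>2" by (simp add: power_mult[symmetric])
    then have "energy_step e s = 2 * s + 2 * s ^ 3 / 3 + n * (2 + 2 * s\<^sup>2 + 8 / 3 * s * n + 4 / 3 * n\<^sup>2)"
      by (simp add: energy_step_def e(2) n_def)
    moreover have "n * (E (k + 1) - E k - (2 * s + 2 * s ^ 3 / 3 + n * (2 + 2 * s\<^sup>2 + 8 / 3 * s * n + 4 / 3 * n\<^sup>2))) = 0"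
    proof -
      have "n * (E (k + 1) - E k) =
         2 / 3 * (real N * n) * (((1 + s) / 2 + n) ^ 4 + (1 - ((1 + s) / 2 + n)) ^ 4 - ((1 + s) / 2) ^ 4 - (1 - (1 + s) / 2) ^ 4)"
        unfolding E_def kN kN1 by (simp add: algebra_simps)
      also have "\<dots> = n * (2 * s + 2 * s ^ 3 / 3 + n * (2 + 2 * s\<^sup>2 + 8 / 3 * s * n + 4 / 3 * n\<^sup>2))"
        unfolding n(2) by (simp add: field_simps) (simp add: eval_nat_numeral algebra_simps)
      finally show ?thesis by (simp add: right_diff_distrib)
    qed
    ultimately show ?thesis using n(1) by (simp add: s_def)
  qed
  have A: "(\<Sum>X\<in>configs 2 N. cfg_weight N X * ((1 + 2 * e * fluct N X) * g (fluct N X))) =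
     2 / real N * (\<Sum>X\<in>configs 2 N. twos N X * (exp (E (twos N X)) * g (pos (twos N X))))"
    unfolding sum_distrib_left
  proof (rule sum.cong[OF refl])
    fix X assume X: "X \<in> configs 2 N"
    have "1 + 2 * e * pos (twos N X) = 2 / real N * twos N X"
      using k[of "twos N X"] N by (simp add: field_simps)
    then show "cfg_weight N X * ((1 + 2 * e * fluct N X) * g (fluct N X)) =
      2 / real N * (twos N X * (exp (E (twos N X)) * g (pos (twos N X))))"
      unfolding w[OF X] fl by simp
  qed
  have B: "(\<Sum>X\<in>configs 2 N. cfg_weight N X * ((1 - 2 * e * fluct N X) * exp (energy_step e (2 * e * fluct N X)) * g (fluct N X + e ^ 5))) =
     2 / real N * (\<Sum>X\<in>configs 2 N. (real N - twos N X) * (exp (E (twos N X + 1)) * g (pos (twos N X + 1))))"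
    unfolding sum_distrib_left
  proof (rule sum.cong[OF refl])
    fix X assume X: "X \<in> configs 2 N"
    have "1 - 2 * e * pos (twos N X) = 2 / real N * (real N - twos N X)"
      using k[of "twos N X"] N by (simp add: field_simps)
    then show "cfg_weight N X * ((1 - 2 * e * fluct N X) * exp (energy_step e (2 * e * fluct N X)) * g (fluct N X + e ^ 5)) =
      2 / real N * ((real N - twos N X) * (exp (E (twos N X + 1)) * g (pos (twos N X + 1))))"
      unfolding w[OF X] fl pos1 E1 exp_add by simp
  qed
  show ?thesis
    unfolding gibbs_mean_def A B using flip_identity[of N "\<lambda>k. exp (E k) * g (pos k)"] by simp
qed

lemma gibbs_mean_mono:
  assumes "N \<ge> 1" "\<And>x. \<bar>2 * eps N * x\<bar> \<le> 1 \<Longrightarrow> \<phi> x \<le> \<psi> x"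
  shows "gibbs_mean N \<phi> \<le> gibbs_mean N \<psi>"
  unfolding gibbs_mean_def using sum_cfg_weight_pos[of N] assms fluct_range[OF assms(1)] cfg_weight_pos
  by (intro divide_right_mono sum_mono mult_left_mono) (auto intro: less_imp_le)

lemma gibbs_mean_add: "gibbs_mean N (\<lambda>x. \<phi> x + \<psi> x) = gibbs_mean N \<phi> + gibbs_mean N \<psi>"
  by (simp add: gibbs_mean_def sum.distrib distrib_left add_divide_distrib)

lemma gibbs_mean_diff: "gibbs_mean N (\<lambda>x. \<phi> x - \<psi> x) = gibbs_mean N \<phi> - gibbs_mean N \<psi>"
  by (simp add: gibbs_mean_def sum_subtractf right_diff_distrib diff_divide_distrib)

lemma gibbs_mean_cmult: "gibbs_mean N (\<lambda>x. c * \<phi> x) = c * gibbs_mean N \<phi>"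
  by (simp add: gibbs_mean_def sum_distrib_left mult.left_commute)

lemma gibbs_mean_const: "gibbs_mean N (\<lambda>x. c) = c"
  using sum_cfg_weight_pos[of N] by (simp add: gibbs_mean_def sum_distrib_right[symmetric])

lemma gibbs_mean_abs: "\<bar>gibbs_mean N \<phi>\<bar> \<le> gibbs_mean N (\<lambda>x. \<bar>\<phi> x\<bar>)"
proof -
  have "\<bar>\<Sum>X\<in>configs 2 N. cfg_weight N X * \<phi> (fluct N X)\<bar> \<le> (\<Sum>X\<in>configs 2 N. cfg_weight N X * \<bar>\<phi> (fluct N X)\<bar>)"
    using cfg_weight_pos by (intro order.trans[OF sum_abs] sum_mono) (auto simp: abs_mult less_imp_le)
  then show ?thesis
    using sum_cfg_weight_pos[of N] by (simp add: gibbs_mean_def abs_divide divide_right_mono)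
qed

lemma gibbs_mean_abs_le:
  assumes "N \<ge> 1" "\<And>x. \<bar>2 * eps N * x\<bar> \<le> 1 \<Longrightarrow> \<bar>\<phi> x\<bar> \<le> \<psi> x"
  shows "\<bar>gibbs_mean N \<phi>\<bar> \<le> gibbs_mean N \<psi>"
  using gibbs_mean_abs[of N \<phi>] gibbs_mean_mono[OF assms(1), of "\<lambda>x. \<bar>\<phi> x\<bar>" \<psi>] assms(2) by force

text \<open>
  The exact identity with the part of the energy increment that is of order \<open>1/N = e\<^sup>6\<close> dropped.  The
  factor \<open>1 + s + drift s\<close> is \<open>(1 - s) exp (2 s + 2 s\<^sup>3 / 3)\<close>.
\<close>

lemma approx_stein_identity:
  obtains C where "C \<ge> 0"
    "\<And>N g. N \<ge> 1 \<Longrightarrow>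
      \<bar>gibbs_mean N (\<lambda>x. (1 + 2 * eps N * x + drift (2 * eps N * x)) * (g (x + eps N ^ 5) - g x)
                  + drift (2 * eps N * x) * g x)\<bar>
        \<le> C * eps N ^ 6 * gibbs_mean N (\<lambda>x. \<bar>g (x + eps N ^ 5)\<bar>)"
proof
  let ?C = "2 * exp (8 / 3) * (8 * exp 8) :: real"
  show "?C \<ge> 0" by simp
  fix N :: nat and g :: "real \<Rightarrow> real"
  assume N: "N \<ge> 1"
  define e where "e = eps N"
  have e: "0 < e" "e \<le> 1" using eps_bounds[OF N] by (auto simp: e_def)
  have eq: "gibbs_mean N (\<lambda>x. (1 + 2 * e * x + drift (2 * e * x)) * (g (x + e ^ 5) - g x) + drift (2 * e * x) * g x) =
    gibbs_mean N (\<lambda>x. (1 - 2 * e * x) *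
      (exp (2 * (2 * e * x) + 2 * (2 * e * x) ^ 3 / 3) - exp (energy_step e (2 * e * x))) * g (x + e ^ 5))"
    (is "gibbs_mean N ?L = gibbs_mean N ?R")
  proof -
    have "?L = (\<lambda>x. ?R x + ((1 - 2 * e * x) * exp (energy_step e (2 * e * x)) * g (x + e ^ 5) - (1 + 2 * e * x) * g x))"
      by (rule ext) (simp add: drift_def algebra_simps)
    then have "gibbs_mean N ?L = gibbs_mean N ?R + (gibbs_mean N (\<lambda>x. (1 - 2 * e * x) * exp (energy_step e (2 * e * x)) * g (x + e ^ 5))
        - gibbs_mean N (\<lambda>x. (1 + 2 * e * x) * g x))"
      by (simp only: gibbs_mean_add gibbs_mean_diff)
    then show ?thesis using gibbs_mean_flip[OF N, of g] by (simp add: e_def)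
  qed
  have "\<bar>gibbs_mean N (\<lambda>x. (1 - 2 * e * x) *
      (exp (2 * (2 * e * x) + 2 * (2 * e * x) ^ 3 / 3) - exp (energy_step e (2 * e * x))) * g (x + e ^ 5))\<bar>
      \<le> gibbs_mean N (\<lambda>x. ?C * e ^ 6 * \<bar>g (x + e ^ 5)\<bar>)"
  proof (rule gibbs_mean_abs_le[OF N])
    fix x assume x: "\<bar>2 * eps N * x\<bar> \<le> 1"
    define s where "s = 2 * e * x"
    define r where "r = e ^ 6 * (2 + 2 * s\<^sup>2 + 8 / 3 * s * e ^ 6 + 4 / 3 * e ^ 12)"
    have s: "\<bar>s\<bar> \<le> 1" using x by (simp add: s_def e_def)
    have e6: "0 \<le> e ^ 6" "e ^ 6 \<le> 1" "0 \<le> e ^ 12" "e ^ 12 \<le> 1" using e by (auto intro: power_le_one)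
    have se: "\<bar>s * e ^ 6\<bar> \<le> \<bar>s\<bar> * 1"
      unfolding abs_mult using e6 by (intro mult_left_mono) auto
    have s2: "s\<^sup>2 \<le> 1" using s by (simp add: abs_square_le_1)
    have "0 \<le> (1 - \<bar>s\<bar>)\<^sup>2" by simp
    then have "2 * \<bar>s\<bar> \<le> 1 + s\<^sup>2" by (simp add: power2_diff)
    then have lo: "0 \<le> 2 + 2 * s\<^sup>2 + 8 / 3 * s * e ^ 6 + 4 / 3 * e ^ 12" using se e6 by linarith
    have hi: "2 + 2 * s\<^sup>2 + 8 / 3 * s * e ^ 6 + 4 / 3 * e ^ 12 \<le> 8" using se e6 s2 s by linarith
    have r: "0 \<le> r" "r \<le> 8 * e ^ 6" 
      unfolding r_def using lo hi e6 by (auto intro: mult_nonneg_nonneg simp: mult.commute[of _ "e ^ 6"] mult_left_mono)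
    then have r8: "r \<le> 8" using e6 by linarith
    have "1 - exp (- r) \<le> r" using exp_ge_add_one_self[of "- r"] by linarith
    then have "exp r * (1 - exp (- r)) \<le> exp 8 * r"
      using r r8 by (intro mult_mono) auto
    then have "exp r - 1 \<le> exp 8 * r" by (simp add: right_diff_distrib exp_add[symmetric])
    also have "\<dots> \<le> exp 8 * (8 * e ^ 6)" using r by (intro mult_left_mono) auto
    finally have er: "\<bar>1 - exp r\<bar> \<le> exp 8 * (8 * e ^ 6)" using r by simp
    have "\<bar>s ^ 3\<bar> \<le> 1" using s by (simp add: power_abs power_le_one)
    then have th: "2 * s + 2 * s ^ 3 / 3 \<le> 8 / 3" using s by linarith
    have "\<bar>(1 - s) * (exp (2 * s + 2 * s ^ 3 / 3) - exp (energy_step e s)) * g (x + e ^ 5)\<bar>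
       = \<bar>1 - s\<bar> * exp (2 * s + 2 * s ^ 3 / 3) * \<bar>1 - exp r\<bar> * \<bar>g (x + e ^ 5)\<bar>"
    proof -
      have "exp (2 * s + 2 * s ^ 3 / 3) - exp (energy_step e s) = exp (2 * s + 2 * s ^ 3 / 3) * (1 - exp r)"
        unfolding energy_step_def r_def[symmetric] exp_add by (simp add: algebra_simps)
      then show ?thesis by (simp add: abs_mult)
    qed
    also have "\<dots> \<le> 2 * exp (8 / 3) * (exp 8 * (8 * e ^ 6)) * \<bar>g (x + e ^ 5)\<bar>"
      using s th er by (intro mult_right_mono mult_mono) auto
    finally show "\<bar>(1 - 2 * e * x) * (exp (2 * (2 * e * x) + 2 * (2 * e * x) ^ 3 / 3) - exp (energy_step e (2 * e * x)))
        * g (x + e ^ 5)\<bar> \<le> ?C * e ^ 6 * \<bar>g (x + e ^ 5)\<bar>"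
      by (simp add: s_def mult_ac)
  qed
  then show "\<bar>gibbs_mean N (\<lambda>x. (1 + 2 * eps N * x + drift (2 * eps N * x)) * (g (x + eps N ^ 5) - g x)
                  + drift (2 * eps N * x) * g x)\<bar>
        \<le> ?C * eps N ^ 6 * gibbs_mean N (\<lambda>x. \<bar>g (x + eps N ^ 5)\<bar>)"
    unfolding eq[symmetric] gibbs_mean_cmult unfolding e_def .
qed

section \<open>Moments\<close>

text \<open>
  With \<open>g x = x\<^sup>3\<close>, coercivity of the drift turns the drift term into at least \<open>4/5 e\<^sup>5 x\<^sup>8\<close>, whereas all
  other terms are \<open>e\<^sup>5\<close> times cubic expressions, which the eighth power absorbs.
\<close>

lemma eighth_moment_bound: "\<exists>M. \<forall>N\<ge>1. gibbs_mean N (\<lambda>x. x ^ 8) \<le> M"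
proof -
  obtain C where C: "C \<ge> 0" and id:
    "\<And>N g. N \<ge> 1 \<Longrightarrow>
      \<bar>gibbs_mean N (\<lambda>x. (1 + 2 * eps N * x + drift (2 * eps N * x)) * (g (x + eps N ^ 5) - g x)
                  + drift (2 * eps N * x) * g x)\<bar>
        \<le> C * eps N ^ 6 * gibbs_mean N (\<lambda>x. \<bar>g (x + eps N ^ 5)\<bar>)"
    using approx_stein_identity by blast
  define b :: real where "b = 2 * exp (8 / 3)"
  define k where "k = 7 * b + 8 * C"
  have k: "k \<ge> 0" using C by (simp add: k_def b_def)
  \<comment> \<open>Beyond \<open>T\<close> the eighth power wins; \<open>D\<close> bounds the cubic below it.\<close>
  define T where "T = max 1 (5 * k)"
  define D where "D = k * (1 + T ^ 3)"
  have T: "T \<ge> 1" "T \<ge> 5 * k" by (auto simp: T_def)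
  have absorb: "k * (1 + \<bar>x\<bar> ^ 3) \<le> 2 / 5 * x ^ 8 + D" for x :: real
  proof (cases "\<bar>x\<bar> \<le> T")
    case True
    then have "k * (1 + \<bar>x\<bar> ^ 3) \<le> D"
      unfolding D_def using k by (intro mult_left_mono add_left_mono power_mono) auto
    moreover have "x ^ 8 \<ge> 0" by simp
    ultimately show ?thesis by linarith
  next
    case False
    define y where "y = \<bar>x\<bar>"
    have y: "y \<ge> 1" "5 * k \<le> y" using False T by (auto simp: y_def)
    have "1 + y ^ 3 \<le> 2 * y ^ 3" using y by simp
    then have "k * (1 + y ^ 3) \<le> (y / 5) * (2 * y ^ 3)"
      using k y by (intro mult_mono) auto
    also have "\<dots> = 2 / 5 * y ^ 4" by (simp add: eval_nat_numeral)
    also have "\<dots> \<le> 2 / 5 * y ^ 8" using y by (intro mult_left_mono power_increasing) auto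
    also have "y ^ 8 = x ^ 8" by (simp add: y_def)
    finally have "k * (1 + \<bar>x\<bar> ^ 3) \<le> 2 / 5 * x ^ 8" by (simp add: y_def)
    moreover have "D \<ge> 0" using k T by (simp add: D_def)
    ultimately show ?thesis by linarith
  qed
  have "gibbs_mean N (\<lambda>x. x ^ 8) \<le> 5 / 2 * D" if N: "N \<ge> 1" for N
  proof -
    define e where "e = eps N"
    have e: "0 < e" "e \<le> 1" using eps_bounds[OF N] by (auto simp: e_def)
    have e5: "0 < e ^ 5" "e ^ 5 \<le> 1" using e by (auto intro: power_le_one)
    have e65: "e ^ 6 \<le> e ^ 5" using e by (intro power_decreasing) auto
    have p: "x\<^sup>2 \<le> 1 + \<bar>x\<bar> ^ 3" "\<bar>x\<bar> \<le> 1 + \<bar>x\<bar> ^ 3" for x :: real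
    proof -
      have "\<bar>x\<bar> ^ j \<le> 1 + \<bar>x\<bar> ^ 3" if "j \<le> 3" for j
      proof (cases "\<bar>x\<bar> \<le> 1")
        case True
        then have "\<bar>x\<bar> ^ j \<le> 1" by (simp add: power_le_one)
        then show ?thesis by (simp add: add_increasing2)
      next
        case False
        then have "\<bar>x\<bar> ^ j \<le> \<bar>x\<bar> ^ 3" using that by (intro power_increasing) auto
        then show ?thesis by simp
      qed
      from this[of 2] this[of 1] show "x\<^sup>2 \<le> 1 + \<bar>x\<bar> ^ 3" "\<bar>x\<bar> \<le> 1 + \<bar>x\<bar> ^ 3" by auto
    qed
    have "4 / 5 * e ^ 5 * gibbs_mean N (\<lambda>x. x ^ 8) = gibbs_mean N (\<lambda>x. 4 / 5 * e ^ 5 * x ^ 8)"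
      by (simp only: gibbs_mean_cmult)
    also have "\<dots> \<le> gibbs_mean N (\<lambda>x. 7 * b * e ^ 5 * (1 + \<bar>x\<bar> ^ 3) -
        ((1 + 2 * e * x + drift (2 * e * x)) * ((x + e ^ 5) ^ 3 - x ^ 3) + drift (2 * e * x) * x ^ 3))"
    proof (rule gibbs_mean_mono[OF N])
      fix x assume x: "\<bar>2 * eps N * x\<bar> \<le> 1"
      define s where "s = 2 * e * x"
      have s: "\<bar>s\<bar> \<le> 1" using x by (simp add: s_def e_def)
      have "s * drift s \<le> - (s ^ 6 / 40)" by (rule drift_coercive[OF s])
      then have "2 * e * (x * drift s) \<le> 2 * e * (- (4 / 5) * e ^ 5 * x ^ 6)"
        by (simp add: s_def power_mult_distrib) (simp add: eval_nat_numeral algebra_simps)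
      then have "x * drift s \<le> - (4 / 5) * e ^ 5 * x ^ 6"
        by (rule mult_left_le_imp_le) (use e in simp)
      then have "x\<^sup>2 * (x * drift s) \<le> x\<^sup>2 * (- (4 / 5) * e ^ 5 * x ^ 6)" by (intro mult_left_mono) auto
      then have 1: "drift s * x ^ 3 \<le> - (4 / 5 * e ^ 5 * x ^ 8)"
        by (simp add: eval_nat_numeral algebra_simps)
      have "\<bar>s ^ 3\<bar> \<le> 1" using s by (simp add: power_abs power_le_one)
      then have th: "2 * s + 2 * s ^ 3 / 3 \<le> 8 / 3" using s by linarith
      have B: "\<bar>1 + s + drift s\<bar> \<le> b"
      proof -
        have "\<bar>1 + s + drift s\<bar> = \<bar>1 - s\<bar> * exp (2 * s + 2 * s ^ 3 / 3)"
          by (simp add: drift_def abs_mult)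
        also have "\<dots> \<le> b" unfolding b_def using s th by (intro mult_mono) auto
        finally show ?thesis .
      qed
      have gen: "\<bar>3 * p + 3 * q + r\<bar> \<le> 7 * (1 + t)"
        if "\<bar>q\<bar> \<le> y" "0 \<le> (r::real)" "r \<le> 1" "0 \<le> p" "p \<le> 1 + t" "y \<le> 1 + t" "0 \<le> t" for p q r t y
        using that by (simp add: abs_le_iff)
      have cube: "\<bar>(x + e ^ 5) ^ 3 - x ^ 3\<bar> \<le> e ^ 5 * (7 * (1 + \<bar>x\<bar> ^ 3))"
      proof -
        have "(x + e ^ 5) ^ 3 - x ^ 3 = e ^ 5 * (3 * x\<^sup>2 + 3 * (x * e ^ 5) + e ^ 5 * e ^ 5)"
          by (simp add: power3_eq_cube power2_eq_square algebra_simps)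
        moreover have "\<bar>x * e ^ 5\<bar> \<le> \<bar>x\<bar> * 1" unfolding abs_mult using e5 by (intro mult_left_mono) auto
        moreover have "e ^ 5 * e ^ 5 \<le> 1 * 1" using e5 by (intro mult_mono) auto
        moreover have "0 \<le> e ^ 5 * e ^ 5" "0 \<le> x\<^sup>2" "0 \<le> \<bar>x\<bar> ^ 3" using e5 by auto
        ultimately have "\<bar>3 * x\<^sup>2 + 3 * (x * e ^ 5) + e ^ 5 * e ^ 5\<bar> \<le> 7 * (1 + \<bar>x\<bar> ^ 3)"
          using p[of x] by (intro gen[of _ "\<bar>x\<bar>"]) auto
        then show ?thesis
          unfolding \<open>(x + e ^ 5) ^ 3 - x ^ 3 = _\<close> abs_mult using e5 by (simp add: mult_left_mono)
      qed
      have "\<bar>(1 + s + drift s) * ((x + e ^ 5) ^ 3 - x ^ 3)\<bar> \<le> b * (e ^ 5 * (7 * (1 + \<bar>x\<bar> ^ 3)))"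
        unfolding abs_mult using B cube by (intro mult_mono) (auto simp: b_def)
      then have 2: "(1 + s + drift s) * ((x + e ^ 5) ^ 3 - x ^ 3) \<le> 7 * b * e ^ 5 * (1 + \<bar>x\<bar> ^ 3)"
        using abs_ge_self[of "(1 + s + drift s) * ((x + e ^ 5) ^ 3 - x ^ 3)"]
        by (simp only: mult_ac)
      show "4 / 5 * e ^ 5 * x ^ 8 \<le> 7 * b * e ^ 5 * (1 + \<bar>x\<bar> ^ 3) -
        ((1 + 2 * e * x + drift (2 * e * x)) * ((x + e ^ 5) ^ 3 - x ^ 3) + drift (2 * e * x) * x ^ 3)"
        using 1 2 unfolding s_def by linarith
    qed
    also have "\<dots> \<le> 7 * b * e ^ 5 * gibbs_mean N (\<lambda>x. 1 + \<bar>x\<bar> ^ 3) + C * e ^ 6 * gibbs_mean N (\<lambda>x. \<bar>(x + e ^ 5) ^ 3\<bar>)"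
      using id[OF N, of "\<lambda>x. x ^ 3"] unfolding gibbs_mean_diff gibbs_mean_cmult e_def[symmetric] by linarith
    also have "\<dots> \<le> 7 * b * e ^ 5 * gibbs_mean N (\<lambda>x. 1 + \<bar>x\<bar> ^ 3) + C * e ^ 5 * gibbs_mean N (\<lambda>x. 8 * (1 + \<bar>x\<bar> ^ 3))"
    proof (intro add_left_mono mult_mono mult_left_mono gibbs_mean_mono[OF N])
      fix x :: real
      have "\<bar>x + e ^ 5\<bar> \<le> 1 + \<bar>x\<bar>" using e5 by linarith
      then have "\<bar>x + e ^ 5\<bar> ^ 3 \<le> (1 + \<bar>x\<bar>) ^ 3" by (intro power_mono) auto
      also have "\<dots> = 1 + 3 * \<bar>x\<bar> + 3 * x\<^sup>2 + \<bar>x\<bar> ^ 3"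
        by (simp add: power3_eq_cube power2_eq_square algebra_simps)
      also have "\<dots> \<le> 8 * (1 + \<bar>x\<bar> ^ 3)" using p[of x] by (simp add: algebra_simps)
      finally show "\<bar>(x + e ^ 5) ^ 3\<bar> \<le> 8 * (1 + \<bar>x\<bar> ^ 3)" by (simp add: power_abs)
    next
      have "gibbs_mean N (\<lambda>x. 0) \<le> gibbs_mean N (\<lambda>x. \<bar>(x + e ^ 5) ^ 3\<bar>)" by (intro gibbs_mean_mono[OF N]) auto
      then show "0 \<le> gibbs_mean N (\<lambda>x. \<bar>(x + e ^ 5) ^ 3\<bar>)" by (simp add: gibbs_mean_const)
    qed (use C e65 e5 in auto)
    also have "\<dots> = e ^ 5 * gibbs_mean N (\<lambda>x. k * (1 + \<bar>x\<bar> ^ 3))"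
      unfolding gibbs_mean_cmult by (simp add: k_def algebra_simps)
    also have "\<dots> \<le> e ^ 5 * gibbs_mean N (\<lambda>x. 2 / 5 * x ^ 8 + D)"
      using e5 absorb by (intro mult_left_mono gibbs_mean_mono[OF N]) auto
    also have "\<dots> = e ^ 5 * (2 / 5 * gibbs_mean N (\<lambda>x. x ^ 8) + D)"
      unfolding gibbs_mean_add gibbs_mean_cmult gibbs_mean_const by simp
    finally have "e ^ 5 * (4 / 5 * gibbs_mean N (\<lambda>x. x ^ 8)) \<le> e ^ 5 * (2 / 5 * gibbs_mean N (\<lambda>x. x ^ 8) + D)"
      by (simp add: mult_ac)
    then have "4 / 5 * gibbs_mean N (\<lambda>x. x ^ 8) \<le> 2 / 5 * gibbs_mean N (\<lambda>x. x ^ 8) + D" using e5 by simp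
    then show ?thesis by simp
  qed
  then show ?thesis by blast
qed

text \<open>
  All error terms below are bounded by a multiple of this one function, which dominates every
  polynomial of degree at most eight.
\<close>

lemma polynomial_moment_bound:
  obtains M where "M \<ge> 0" "\<And>N. N \<ge> 1 \<Longrightarrow> gibbs_mean N (\<lambda>x. (2 + \<bar>x\<bar>) ^ 8) \<le> M"
proof -
  obtain M where M: "\<And>N. N \<ge> 1 \<Longrightarrow> gibbs_mean N (\<lambda>x. x ^ 8) \<le> M" using eighth_moment_bound by blast
  have pw: "(2 + \<bar>x\<bar>) ^ 8 \<le> 6561 * (1 + x ^ 8)" for x :: real
  proof -
    have "2 + \<bar>x\<bar> \<le> 3 * max 1 \<bar>x\<bar>" by (auto simp: max_def)
    then have "(2 + \<bar>x\<bar>) ^ 8 \<le> (3 * max 1 \<bar>x\<bar>) ^ 8" by (intro power_mono) auto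
    also have "\<dots> = 6561 * (max 1 \<bar>x\<bar>) ^ 8" by (simp add: power_mult_distrib)
    also have "\<dots> \<le> 6561 * (1 + x ^ 8)"
      using zero_le_even_power[of 8 x] by (intro mult_left_mono) (auto simp: max_def)
    finally show ?thesis .
  qed
  have "gibbs_mean N (\<lambda>x. (2 + \<bar>x\<bar>) ^ 8) \<le> 6561 * (1 + max 0 M)" if N: "N \<ge> 1" for N
  proof -
    have "gibbs_mean N (\<lambda>x. (2 + \<bar>x\<bar>) ^ 8) \<le> gibbs_mean N (\<lambda>x. 6561 * (1 + x ^ 8))"
      by (intro gibbs_mean_mono[OF N] pw)
    also have "\<dots> = 6561 * (1 + gibbs_mean N (\<lambda>x. x ^ 8))" unfolding gibbs_mean_cmult gibbs_mean_add gibbs_mean_const ..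
    also have "\<dots> \<le> 6561 * (1 + max 0 M)" using M[OF N] by auto
    finally show ?thesis .
  qed
  then show thesis by (intro that[of "6561 * (1 + max 0 M)"]) auto
qed

section \<open>The sixth moment\<close>

definition sixth_moment :: "nat \<Rightarrow> real" where
  "sixth_moment N = gibbs_mean N (\<lambda>x. x ^ 6)"

lemma le_two_plus_abs_power8:
  fixes x :: real
  assumes "k \<le> 8"
  shows "(2 + \<bar>x\<bar>) ^ k \<le> (2 + \<bar>x\<bar>) ^ 8"
  using assms by (intro power_increasing) auto

lemma abs_power_le_two_plus_abs_power8:
  fixes x :: real
  assumes "k \<le> 8"
  shows "\<bar>x\<bar> ^ k \<le> (2 + \<bar>x\<bar>) ^ 8"
  by (rule order.trans[OF power_mono le_two_plus_abs_power8]) (use assms in auto)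

lemma drift_linear_bound:
  assumes K: "\<And>s. \<bar>s\<bar> \<le> 1 \<Longrightarrow> \<bar>drift s + 2 / 5 * s ^ 5\<bar> \<le> K * s ^ 6" and s: "\<bar>s\<bar> \<le> 1"
  shows "\<bar>s + drift s\<bar> \<le> (7 / 5 + K) * \<bar>s\<bar>"
proof -
  have K0: "K \<ge> 0" using K[of 1] by simp
  have "\<bar>s\<bar> ^ 5 \<le> \<bar>s\<bar> ^ 1" "\<bar>s\<bar> ^ 6 \<le> \<bar>s\<bar> ^ 1" by (rule power_decreasing; use s in simp)+
  then have s5: "\<bar>s ^ 5\<bar> \<le> \<bar>s\<bar>" and s6: "K * s ^ 6 \<le> K * \<bar>s\<bar>"
    using K0 by (auto simp: power_abs intro!: mult_left_mono)
  have "\<bar>s + drift s\<bar> \<le> \<bar>s\<bar> + (\<bar>drift s + 2 / 5 * s ^ 5\<bar> + 2 / 5 * \<bar>s ^ 5\<bar>)" by linarith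
  also have "\<dots> \<le> \<bar>s\<bar> + (K * \<bar>s\<bar> + 2 / 5 * \<bar>s\<bar>)" using K[OF s] s5 s6 by linarith
  finally show ?thesis by (simp add: algebra_simps)
qed

text \<open>
  Take \<open>g x = x\<close>: then \<open>2/5 s\<^sup>5 x = 64/5 e\<^sup>5 x\<^sup>6\<close>, the increment of \<open>g\<close> is \<open>e\<^sup>5\<close>, and the remaining terms are
  at most \<open>e\<^sup>6\<close> times a polynomial of degree seven in \<open>\<bar>x\<bar>\<close>.
\<close>

lemma sixth_moment_rate:
  obtains C where "C \<ge> 0" "\<And>N. N \<ge> 1 \<Longrightarrow> \<bar>1 - 64 / 5 * sixth_moment N\<bar> \<le> C * eps N"
proof -
  obtain C where C: "C \<ge> 0" and id:
    "\<And>N g. N \<ge> 1 \<Longrightarrow>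
      \<bar>gibbs_mean N (\<lambda>x. (1 + 2 * eps N * x + drift (2 * eps N * x)) * (g (x + eps N ^ 5) - g x)
                  + drift (2 * eps N * x) * g x)\<bar>
        \<le> C * eps N ^ 6 * gibbs_mean N (\<lambda>x. \<bar>g (x + eps N ^ 5)\<bar>)"
    using approx_stein_identity by blast
  obtain M where M: "M \<ge> 0" "\<And>N. N \<ge> 1 \<Longrightarrow> gibbs_mean N (\<lambda>x. (2 + \<bar>x\<bar>) ^ 8) \<le> M"
    using polynomial_moment_bound by blast
  obtain K where K: "\<And>s. \<bar>s\<bar> \<le> 1 \<Longrightarrow> \<bar>drift s + 2 / 5 * s ^ 5\<bar> \<le> K * s ^ 6"
    using drift_expansion by blast
  have K0: "K \<ge> 0" using K[of 1] by simp
  define A where "A = 2 * (7 / 5 + K) + 64 * K"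
  have A: "A \<ge> 0" using K0 by (simp add: A_def)
  have "\<bar>1 - 64 / 5 * sixth_moment N\<bar> \<le> (C + A) * M * eps N" if N: "N \<ge> 1" for N
  proof -
    define e where "e = eps N"
    have e: "0 < e" "e \<le> 1" using eps_bounds[OF N] by (auto simp: e_def)
    have e5: "0 < e ^ 5" "e ^ 5 \<le> 1" using e by (auto intro: power_le_one)
    define L where "L = (\<lambda>x. (1 + 2 * e * x + drift (2 * e * x)) * ((x + e ^ 5) - x) + drift (2 * e * x) * x)"
    have 1: "\<bar>gibbs_mean N L\<bar> \<le> C * e ^ 6 * M"
    proof -
      have "\<bar>gibbs_mean N L\<bar> \<le> C * e ^ 6 * gibbs_mean N (\<lambda>x. \<bar>x + e ^ 5\<bar>)"
        using id[OF N, of "\<lambda>x. x"] by (simp add: L_def e_def)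
      also have "\<dots> \<le> C * e ^ 6 * gibbs_mean N (\<lambda>x. (2 + \<bar>x\<bar>) ^ 8)"
      proof (intro mult_left_mono gibbs_mean_mono[OF N])
        fix x :: real
        have "\<bar>x + e ^ 5\<bar> \<le> 2 + \<bar>x\<bar>" using e5 by linarith
        then show "\<bar>x + e ^ 5\<bar> \<le> (2 + \<bar>x\<bar>) ^ 8"
          by (rule order.trans) (use le_two_plus_abs_power8[of 1 x] in \<open>simp only: power_one_right\<close>)
      qed (use C e in auto)
      also have "\<dots> \<le> C * e ^ 6 * M" using M(2)[OF N] C e by (intro mult_left_mono) auto
      finally show ?thesis .
    qed
    have 2: "\<bar>gibbs_mean N (\<lambda>x. e ^ 5 * (1 - 64 / 5 * x ^ 6) - L x)\<bar> \<le> A * e ^ 6 * M"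
    proof -
      have "\<bar>gibbs_mean N (\<lambda>x. e ^ 5 * (1 - 64 / 5 * x ^ 6) - L x)\<bar> \<le> gibbs_mean N (\<lambda>x. A * e ^ 6 * (2 + \<bar>x\<bar>) ^ 8)"
      proof (rule gibbs_mean_abs_le[OF N])
        fix x assume x: "\<bar>2 * eps N * x\<bar> \<le> 1"
        define s where "s = 2 * e * x"
        have s: "\<bar>s\<bar> \<le> 1" using x by (simp add: s_def e_def)
        have abs_s: "\<bar>s\<bar> = 2 * e * \<bar>x\<bar>" using e by (simp add: s_def abs_mult)
        have "e ^ 5 * (1 - 64 / 5 * x ^ 6) - L x = - ((s + drift s) * e ^ 5 + (drift s + 2 / 5 * s ^ 5) * x)"
          by (simp add: L_def s_def[symmetric])
            (simp add: s_def power_mult_distrib algebra_simps eval_nat_numeral)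
        also have "\<bar>\<dots>\<bar> \<le> \<bar>s + drift s\<bar> * e ^ 5 + \<bar>drift s + 2 / 5 * s ^ 5\<bar> * \<bar>x\<bar>"
        proof -
          have "\<bar>(s + drift s) * e ^ 5\<bar> = \<bar>s + drift s\<bar> * e ^ 5" using e5 by (simp add: abs_mult)
          then show ?thesis
            unfolding abs_minus_cancel
            using abs_triangle_ineq[of "(s + drift s) * e ^ 5" "(drift s + 2 / 5 * s ^ 5) * x"]
            by (simp only: abs_mult)
        qed
        also have "\<dots> \<le> (7 / 5 + K) * \<bar>s\<bar> * e ^ 5 + K * s ^ 6 * \<bar>x\<bar>"
          using e5 by (intro add_mono mult_right_mono K[OF s] drift_linear_bound[OF K s]) auto
        also have "\<dots> = e ^ 6 * (2 * (7 / 5 + K) * \<bar>x\<bar> ^ 1 + 64 * K * \<bar>x\<bar> ^ 7)"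
        proof -
          have "s ^ 6 = 64 * e ^ 6 * \<bar>x\<bar> ^ 6" by (simp add: s_def power_mult_distrib)
          then show ?thesis unfolding abs_s by (simp add: eval_nat_numeral algebra_simps)
        qed
        also have "\<dots> \<le> e ^ 6 * (2 * (7 / 5 + K) * (2 + \<bar>x\<bar>) ^ 8 + 64 * K * (2 + \<bar>x\<bar>) ^ 8)"
          using e K0 by (intro mult_left_mono add_mono abs_power_le_two_plus_abs_power8) auto
        also have "\<dots> = A * e ^ 6 * (2 + \<bar>x\<bar>) ^ 8" unfolding A_def by algebra
        finally show "\<bar>e ^ 5 * (1 - 64 / 5 * x ^ 6) - L x\<bar> \<le> A * e ^ 6 * (2 + \<bar>x\<bar>) ^ 8" .
      qed
      also have "\<dots> \<le> A * e ^ 6 * M"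
        unfolding gibbs_mean_cmult using M(2)[OF N] A e by (intro mult_left_mono) auto
      finally show ?thesis .
    qed
    have "gibbs_mean N (\<lambda>x. e ^ 5 * (1 - 64 / 5 * x ^ 6) - L x) = e ^ 5 * (1 - 64 / 5 * sixth_moment N) - gibbs_mean N L"
      by (simp only: gibbs_mean_diff gibbs_mean_cmult gibbs_mean_const sixth_moment_def)
    with 1 2 have "\<bar>e ^ 5 * (1 - 64 / 5 * sixth_moment N)\<bar> \<le> C * e ^ 6 * M + A * e ^ 6 * M" by linarith
    also have "\<dots> = e ^ 5 * ((C + A) * M * e)" by algebra
    finally have "e ^ 5 * \<bar>1 - 64 / 5 * sixth_moment N\<bar> \<le> e ^ 5 * ((C + A) * M * e)"
      using e5 by (simp add: abs_mult)
    then show ?thesis using e5 by (simp add: e_def)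
  qed
  then show thesis using C A M by (intro that[of "(C + A) * M"]) auto
qed

lemma sixth_moment_pos:
  assumes N: "N \<ge> 1"
  shows "sixth_moment N > 0"
proof -
  let ?X = "\<lambda>i\<in>{1..N}. 2 :: nat"
  have "twos N ?X = (\<Sum>i\<in>{1..N}. 1)" unfolding twos_def by (intro sum.cong) auto
  then have "fluct N ?X = 1 / 2 / eps N"
    using N by (simp add: fluct_def magnetization_2)
  then have "fluct N ?X ^ 6 > 0" using eps_bounds[OF N] by simp
  then have "(\<Sum>X\<in>configs 2 N. cfg_weight N X * fluct N X ^ 6) > 0"
    using configs_2_const[of N] cfg_weight_pos
    by (intro sum_pos2[of _ ?X]) (auto intro!: mult_nonneg_nonneg less_imp_le[OF cfg_weight_pos])
  then show ?thesis
    unfolding sixth_moment_def gibbs_mean_def using sum_cfg_weight_pos by (intro divide_pos_pos)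
qed

lemma eps_tendsto_0: "eps \<longlonglongrightarrow> 0"
  unfolding eps_def by real_asymp

text \<open>
  For large \<open>N\<close> the lower bound comes from the limit \<open>5/64\<close>; the finitely many remaining moments are
  positive.
\<close>

lemma sixth_moment_bounds:
  obtains a0 a1 where "0 < a0" "\<And>N. N \<ge> 1 \<Longrightarrow> a0 \<le> sixth_moment N" "\<And>N. N \<ge> 1 \<Longrightarrow> sixth_moment N \<le> a1"
proof -
  obtain C where C: "C \<ge> 0" "\<And>N. N \<ge> 1 \<Longrightarrow> \<bar>1 - 64 / 5 * sixth_moment N\<bar> \<le> C * eps N"
    using sixth_moment_rate by blast
  have "(\<lambda>N. C * eps N) \<longlonglongrightarrow> C * 0" by (intro tendsto_intros eps_tendsto_0)
  then have "\<forall>\<^sub>F N in sequentially. C * eps N < 1 / 2"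
    by (rule order_tendstoD) simp
  then obtain N0 where N0: "\<And>N. N \<ge> N0 \<Longrightarrow> C * eps N < 1 / 2"
    by (auto simp: eventually_sequentially)
  define a0 where "a0 = Min (insert (5 / 128) (sixth_moment ` {1..N0}))"
  have "a0 > 0" unfolding a0_def using sixth_moment_pos by (subst Min_gr_iff) auto
  moreover have "a0 \<le> sixth_moment N" if N: "N \<ge> 1" for N
  proof (cases "N \<le> N0")
    case True
    then show ?thesis unfolding a0_def using N by (intro Min_le) auto
  next
    case False
    then have "5 / 128 \<le> sixth_moment N" using C(2)[OF N] N0[of N] by linarith
    moreover have "a0 \<le> 5 / 128" unfolding a0_def by (intro Min_le) auto
    ultimately show ?thesis by linarith
  qed
  moreover have "sixth_moment N \<le> 5 / 64 * (1 + C)" if N: "N \<ge> 1" for N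
  proof -
    have "C * eps N \<le> C * 1" using C eps_bounds[OF N] by (intro mult_left_mono) auto
    with C(2)[OF N] have "64 / 5 * sixth_moment N \<le> 1 + C" unfolding abs_le_iff by linarith
    then show ?thesis by (simp add: field_simps)
  qed
  ultimately show thesis by (rule that)
qed

lemma power5_diff_le:
  fixes x y d :: real
  assumes "x \<le> y" "y \<le> x + d" "d \<le> 1"
  shows "\<bar>y ^ 5 - x ^ 5\<bar> \<le> 5 * (2 + \<bar>x\<bar>) ^ 4 * d"
proof -
  have "norm (y ^ 5 - x ^ 5) \<le> 5 * (2 + \<bar>x\<bar>) ^ 4 * norm (y - x)"
  proof (rule field_differentiable_bound[of "{x..y}" "\<lambda>x. x ^ 5" "\<lambda>x. 5 * x ^ 4"])
    fix z assume z: "z \<in> {x..y}"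
    show "((\<lambda>x. x ^ 5) has_field_derivative 5 * z ^ 4) (at z within {x..y})"
      by (auto intro!: derivative_eq_intros)
    have "\<bar>z\<bar> \<le> 2 + \<bar>x\<bar>" using z assms by auto
    then have "\<bar>z\<bar> ^ 4 \<le> (2 + \<bar>x\<bar>) ^ 4" by (intro power_mono) auto
    then show "norm (5 * z ^ 4) \<le> 5 * (2 + \<bar>x\<bar>) ^ 4" by simp
  qed (use assms in auto)
  also have "\<dots> \<le> 5 * (2 + \<bar>x\<bar>) ^ 4 * d" using assms by (intro mult_left_mono) auto
  finally show ?thesis by simp
qed

section \<open>Comparison with the sextic law\<close>

lemma stein_const_mono:
  assumes "0 < c0" "c0 \<le> c" "c \<le> c1"
  shows "stein_const c \<le> exp c1 * (2 + 1 / (3 * c0))"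
  unfolding stein_const_def using assms
  by (intro mult_mono add_mono divide_left_mono) auto

text \<open>
  Let \<open>f\<close> solve the Stein equation for \<open>g\<close> and the law normalized by \<open>a = E F\<^sup>6\<close>, so that
  \<open>g - E g = f' - x\<^sup>5 f / a\<close>.  The approximate identity for \<open>f\<close> controls the mean of
  \<open>f' - 64/5 x\<^sup>5 f\<close>, and \<open>1/a - 64/5 = O(e)\<close>.  Replacing \<open>(f (x + e\<^sup>5) - f x) / e\<^sup>5\<close> by \<open>f' x\<close> needs the
  modulus of continuity of \<open>f'\<close> on the scale \<open>e\<^sup>5\<close>; since \<open>f'\<close> contains \<open>g\<close>, this is where the Lipschitz
  constant enters, and \<open>1/e\<close> is affordable because \<open>e\<^sup>5 / e = e\<^sup>4 \<le> e\<close>.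
\<close>

lemma stein_comparison:
  "\<exists>C\<ge>0. \<forall>N\<ge>1. \<forall>g. (\<forall>x y. \<bar>g x - g y\<bar> \<le> \<bar>x - y\<bar> / eps N) \<longrightarrow> (\<forall>x. \<bar>g x\<bar> \<le> 1 + \<bar>x\<bar>) \<longrightarrow>
      \<bar>gibbs_mean N g - (LINT x|sextic_law (sixth_moment N). g x)\<bar> \<le> C * eps N"
proof -
  obtain C where C: "C \<ge> 0" and id:
    "\<And>N g. N \<ge> 1 \<Longrightarrow>
      \<bar>gibbs_mean N (\<lambda>x. (1 + 2 * eps N * x + drift (2 * eps N * x)) * (g (x + eps N ^ 5) - g x)
                  + drift (2 * eps N * x) * g x)\<bar>
        \<le> C * eps N ^ 6 * gibbs_mean N (\<lambda>x. \<bar>g (x + eps N ^ 5)\<bar>)"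
    using approx_stein_identity by blast
  obtain M where M: "M \<ge> 0" "\<And>N. N \<ge> 1 \<Longrightarrow> gibbs_mean N (\<lambda>x. (2 + \<bar>x\<bar>) ^ 8) \<le> M"
    using polynomial_moment_bound by blast
  obtain K where K: "\<And>s. \<bar>s\<bar> \<le> 1 \<Longrightarrow> \<bar>drift s + 2 / 5 * s ^ 5\<bar> \<le> K * s ^ 6"
    using drift_expansion by blast
  have K0: "K \<ge> 0" using K[of 1] by simp
  obtain a0 a1 where a0: "0 < a0" "\<And>N. N \<ge> 1 \<Longrightarrow> a0 \<le> sixth_moment N"
    and a1: "\<And>N. N \<ge> 1 \<Longrightarrow> sixth_moment N \<le> a1"
    using sixth_moment_bounds by blast
  have a1_pos: "a1 > 0" using a0(1) a1[OF order.refl] a0(2)[OF order.refl] by linarith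
  obtain Ca where Ca: "Ca \<ge> 0" "\<And>N. N \<ge> 1 \<Longrightarrow> \<bar>1 - 64 / 5 * sixth_moment N\<bar> \<le> Ca * eps N"
    using sixth_moment_rate by blast
  define c0 where "c0 = 1 / (6 * a1)"
  define c1 where "c1 = 1 / (6 * a0)"
  have c0: "c0 > 0" using a1_pos by (simp add: c0_def)
  have c1: "c1 > 0" using a0 by (simp add: c1_def)
  define k where "k = 2 + sextic_moment c0 / sextic_mass c1"
  have k: "k \<ge> 2"
    using sextic_moment_nonneg[of c0] sextic_mass_pos[OF c1] by (simp add: k_def)
  define T where "T = k * (exp c1 * (2 + 1 / (3 * c0)))"
  have T: "T \<ge> 0" using k c0 by (simp add: T_def)
  \<comment> \<open>Bounds uniform in \<open>N\<close>: \<open>k\<close> for the centred test function, \<open>T\<close> for \<open>f\<close> and \<open>x\<^sup>4 f\<close>, \<open>G\<close> for the slope of \<open>f\<close>.\<close>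
  define G where "G = 6 * c1 * T + k"
  have G: "G \<ge> 0" using k T c1 by (simp add: G_def)
  \<comment> \<open>Errors from \<open>1 + s + drift s \<noteq> 1\<close>, from the difference quotient, and from the drift expansion.\<close>
  define R1 where "R1 = 2 * (7 / 5 + K) * G"
  define R2 where "R2 = 30 * c1 * T + 6 * c1 * G + 1"
  define R3 where "R3 = 64 * K * T"
  have R: "R1 \<ge> 0" "R2 \<ge> 0" "R3 \<ge> 0" using K0 G T c1 by (auto simp: R1_def R2_def R3_def)
  define CC where "CC = C * T + (R1 + R2 + R3) * M + Ca / a0 * T * M"
  have "\<bar>gibbs_mean N g - (LINT x|sextic_law (sixth_moment N). g x)\<bar> \<le> CC * eps N"
    if N: "N \<ge> 1" and lip: "\<And>x y. \<bar>g x - g y\<bar> \<le> \<bar>x - y\<bar> / eps N" and growth: "\<And>x. \<bar>g x\<bar> \<le> 1 + \<bar>x\<bar>"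
    for N g
  proof -
    define e where "e = eps N"
    define a where "a = sixth_moment N"
    define c where "c = 1 / (6 * a)"
    define Eg where "Eg = (LINT x|sextic_law a. g x)"
    define \<phi> where "\<phi> = (\<lambda>x. g x - Eg)"
    have e: "0 < e" "e \<le> 1" using eps_bounds[OF N] by (auto simp: e_def)
    have e5: "0 < e ^ 5" "e ^ 5 \<le> 1" "e ^ 5 \<le> e" "e ^ 5 / e \<le> e"
    proof -
      show "0 < e ^ 5" "e ^ 5 \<le> 1" using e by (auto intro: power_le_one)
      have "e ^ 5 \<le> e ^ 1" "e ^ 4 \<le> e ^ 1" using e by (intro power_decreasing; simp)+
      then show "e ^ 5 \<le> e" "e ^ 5 / e \<le> e" using e by (simp_all add: eval_nat_numeral)
    qed
    have a: "a0 \<le> a" "a \<le> a1" "a > 0" using a0 a1 N by (auto simp: a_def intro: less_le_trans)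
    have c: "c > 0" "c0 \<le> c" "c \<le> c1" using a a0 by (auto simp: c_def c0_def c1_def frac_le)
    have cont: "continuous_on UNIV g"
    proof -
      have "(1 / e)-lipschitz_on UNIV g"
        using lip e by (intro lipschitz_onI) (auto simp: dist_real_def e_def)
      then show ?thesis by (rule lipschitz_on_continuous_on)
    qed
    have g_meas [measurable]: "g \<in> borel_measurable borel"
      using cont by (rule borel_measurable_continuous_onI)
    have g_int: "integrable lborel (\<lambda>x. g x * sextic_weight c x)"
      by (rule integrable_sextic_weight_times[where A = 1]) (use c growth in auto)
    have mass: "sextic_mass c > 0" using sextic_mass_pos[OF c(1)] .
    have Eg_eq: "Eg * sextic_mass c = (LINT x|lborel. g x * sextic_weight c x)"
      using mass unfolding Eg_def by (subst integral_sextic_law[OF a(3) c_def g_meas]) simp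
    have Eg_le: "\<bar>Eg\<bar> \<le> k - 1"
    proof -
      have ab: "integrable lborel (\<lambda>x. \<bar>x\<bar> * sextic_weight c x)"
        by (rule integrable_sextic_weight_times[where A = 1]) (use c in auto)
      have "\<bar>Eg * sextic_mass c\<bar> \<le> (LINT x|lborel. sextic_weight c x + \<bar>x\<bar> * sextic_weight c x)"
        unfolding Eg_eq
      proof (rule order.trans[OF integral_abs_bound], rule integral_mono)
        fix x
        have "\<bar>g x\<bar> * sextic_weight c x \<le> (1 + \<bar>x\<bar>) * sextic_weight c x"
          using growth less_imp_le[OF sextic_weight_pos] by (intro mult_right_mono) auto
        then show "\<bar>g x * sextic_weight c x\<bar> \<le> sextic_weight c x + \<bar>x\<bar> * sextic_weight c x"
          using sextic_weight_pos[of c x] by (simp add: abs_mult distrib_right)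
      qed (use g_int ab c integrable_sextic_weight in auto)
      also have "\<dots> = sextic_mass c + sextic_moment c"
        unfolding sextic_mass_def sextic_moment_def
        by (rule Bochner_Integration.integral_add) (use ab c integrable_sextic_weight in auto)
      finally have "\<bar>Eg\<bar> * sextic_mass c \<le> (1 + sextic_moment c / sextic_mass c) * sextic_mass c"
        using mass by (simp add: abs_mult distrib_right)
      then have "\<bar>Eg\<bar> \<le> 1 + sextic_moment c / sextic_mass c" using mass by simp
      also have "\<dots> \<le> 1 + sextic_moment c0 / sextic_mass c1"
        using sextic_moment_antimono[OF c0 c(2)] sextic_mass_antimono[OF c(1) c(3)]
          sextic_mass_pos[OF c1] sextic_moment_nonneg[of c]
        by (intro add_left_mono frac_le) (auto intro: order.trans[OF sextic_moment_nonneg])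
      finally show ?thesis by (simp add: k_def)
    qed
    have \<phi>_bd: "\<bar>\<phi> x\<bar> \<le> k * (1 + \<bar>x\<bar>)" for x
    proof -
      have "\<bar>\<phi> x\<bar> \<le> k + 1 * \<bar>x\<bar>" using growth[of x] Eg_le by (simp add: \<phi>_def)
      also have "\<dots> \<le> k + k * \<bar>x\<bar>" using k by (intro add_left_mono mult_right_mono) auto
      finally show ?thesis by (simp add: distrib_left)
    qed
    have \<phi>_cont: "continuous_on UNIV \<phi>" unfolding \<phi>_def by (intro continuous_intros cont)
    have \<phi>_int: "integrable lborel (\<lambda>y. \<phi> y * sextic_weight c y)"
      by (rule integrable_sextic_weight_times[OF c(1) _ \<phi>_bd]) (simp add: \<phi>_def)
    have \<phi>_zero: "(LINT y|lborel. \<phi> y * sextic_weight c y) = 0"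
    proof -
      have "(LINT y|lborel. \<phi> y * sextic_weight c y) =
        (LINT y|lborel. g y * sextic_weight c y - Eg * sextic_weight c y)"
        by (simp add: \<phi>_def left_diff_distrib)
      also have "\<dots> = (LINT y|lborel. g y * sextic_weight c y) - (LINT y|lborel. Eg * sextic_weight c y)"
        by (rule Bochner_Integration.integral_diff) (use g_int c integrable_sextic_weight in auto)
      also have "\<dots> = 0" using Eg_eq by (simp add: sextic_mass_def)
      finally show ?thesis .
    qed
    have k0: "0 \<le> k" using k by simp
    obtain f where f: "\<And>x. (f has_real_derivative 6 * c * x ^ 5 * f x + \<phi> x) (at x)"
      "\<And>x. \<bar>f x\<bar> \<le> k * stein_const c" "\<And>x. x ^ 4 * \<bar>f x\<bar> \<le> k * stein_const c"
      using sextic_stein_solution[OF c(1) k0 \<phi>_cont \<phi>_bd \<phi>_int \<phi>_zero] by blast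
    have "k * stein_const c \<le> T"
      unfolding T_def using k0 by (intro mult_left_mono stein_const_mono c0 c)
    then have fT: "\<bar>f x\<bar> \<le> T" "x ^ 4 * \<bar>f x\<bar> \<le> T" for x using f(2,3)[of x] by linarith+
    define f' where "f' = (\<lambda>x. 6 * c * x ^ 5 * f x + \<phi> x)"
    have Df: "(f has_real_derivative f' x) (at x)" for x using f(1) by (simp add: f'_def)
    have f'_bd: "\<bar>f' x\<bar> \<le> G * (1 + \<bar>x\<bar>)" for x
    proof -
      have "\<bar>6 * c * x ^ 5 * f x\<bar> = 6 * c * \<bar>x\<bar> * (x ^ 4 * \<bar>f x\<bar>)"
        using c by (simp add: abs_mult power_abs eval_nat_numeral)
      also have "\<dots> \<le> 6 * c1 * \<bar>x\<bar> * T"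
        using c c1 fT T by (intro mult_mono) auto
      also have "\<dots> \<le> 6 * c1 * T * (1 + \<bar>x\<bar>)" using c1 T by (simp add: algebra_simps)
      finally have "\<bar>6 * c * x ^ 5 * f x\<bar> + \<bar>\<phi> x\<bar> \<le> 6 * c1 * T * (1 + \<bar>x\<bar>) + k * (1 + \<bar>x\<bar>)"
        using \<phi>_bd[of x] by linarith
      moreover have "\<bar>f' x\<bar> \<le> \<bar>6 * c * x ^ 5 * f x\<bar> + \<bar>\<phi> x\<bar>" unfolding f'_def by (rule abs_triangle_ineq)
      ultimately show ?thesis by (simp add: G_def algebra_simps)
    qed
    have f_incr: "\<bar>f y - f x\<bar> \<le> G * (2 + \<bar>x\<bar>) * e ^ 5" if y: "x \<le> y" "y \<le> x + e ^ 5" for x y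
    proof -
      have "norm (f y - f x) \<le> G * (2 + \<bar>x\<bar>) * norm (y - x)"
      proof (rule field_differentiable_bound[of "{x..y}" f f'])
        fix z assume z: "z \<in> {x..y}"
        show "(f has_field_derivative f' z) (at z within {x..y})"
          using Df by (rule has_field_derivative_at_within)
        have "1 + \<bar>z\<bar> \<le> 2 + \<bar>x\<bar>" using z y e5 by auto
        then have "G * (1 + \<bar>z\<bar>) \<le> G * (2 + \<bar>x\<bar>)" using G by (intro mult_left_mono) auto
        with f'_bd[of z] show "norm (f' z) \<le> G * (2 + \<bar>x\<bar>)" by simp
      qed (use y in auto)
      also have "\<dots> \<le> G * (2 + \<bar>x\<bar>) * e ^ 5" using y G by (intro mult_left_mono) auto
      finally show ?thesis by simp
    qed
    have f'_incr: "\<bar>f' y - f' x\<bar> \<le> R2 * e * (2 + \<bar>x\<bar>) ^ 8" if y: "x \<le> y" "y \<le> x + e ^ 5" for x y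
    proof -
      define Y where "Y = (2 + \<bar>x\<bar>) ^ 8"
      have Y: "Y \<ge> 0" "1 \<le> Y" "(2 + \<bar>x\<bar>) ^ 4 \<le> Y" "(2 + \<bar>x\<bar>) ^ 6 \<le> Y"
        unfolding Y_def by (auto intro!: le_two_plus_abs_power8 one_le_power)
      have "f' y - f' x = 6 * c * ((y ^ 5 - x ^ 5) * f y + x ^ 5 * (f y - f x)) + (g y - g x)"
        by (simp add: f'_def \<phi>_def algebra_simps)
      moreover have "\<bar>(y ^ 5 - x ^ 5) * f y\<bar> \<le> 5 * T * (e * Y)"
      proof -
        have "\<bar>(y ^ 5 - x ^ 5) * f y\<bar> \<le> (5 * (2 + \<bar>x\<bar>) ^ 4 * e ^ 5) * T"
          unfolding abs_mult using power5_diff_le[OF y e5(2)] fT e5 by (intro mult_mono) auto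
        also have "\<dots> = 5 * T * (e ^ 5 * (2 + \<bar>x\<bar>) ^ 4)" by (simp only: mult_ac)
        also have "\<dots> \<le> 5 * T * (e * Y)" using Y e5 e T by (intro mult_left_mono mult_mono) auto
        finally show ?thesis .
      qed
      moreover have "\<bar>x ^ 5 * (f y - f x)\<bar> \<le> G * (e * Y)"
      proof -
        have "\<bar>x ^ 5\<bar> \<le> (2 + \<bar>x\<bar>) ^ 5" unfolding power_abs by (intro power_mono) auto
        then have "\<bar>x ^ 5 * (f y - f x)\<bar> \<le> (2 + \<bar>x\<bar>) ^ 5 * (G * (2 + \<bar>x\<bar>) * e ^ 5)"
          unfolding abs_mult using f_incr[OF y] by (intro mult_mono) auto
        also have "\<dots> = G * (e ^ 5 * (2 + \<bar>x\<bar>) ^ 6)" by (simp add: eval_nat_numeral mult_ac)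
        also have "\<dots> \<le> G * (e * Y)" using Y e5 e G by (intro mult_left_mono mult_mono) auto
        finally show ?thesis .
      qed
      moreover have "\<bar>g y - g x\<bar> \<le> e * Y"
      proof -
        have "\<bar>g y - g x\<bar> \<le> \<bar>y - x\<bar> / e" using lip by (simp add: e_def)
        also have "\<dots> \<le> e ^ 5 / e" using y e by (intro divide_right_mono) auto
        also have "\<dots> \<le> e * 1" using e5 by simp
        also have "\<dots> \<le> e * Y" using Y e by (intro mult_left_mono) auto
        finally show ?thesis .
      qed
      ultimately have "\<bar>f' y - f' x\<bar> \<le> 6 * c * (5 * T * (e * Y) + G * (e * Y)) + e * Y"
      proof -
        assume 1: "f' y - f' x = 6 * c * ((y ^ 5 - x ^ 5) * f y + x ^ 5 * (f y - f x)) + (g y - g x)"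
          and 2: "\<bar>(y ^ 5 - x ^ 5) * f y\<bar> \<le> 5 * T * (e * Y)"
          and 3: "\<bar>x ^ 5 * (f y - f x)\<bar> \<le> G * (e * Y)" and 4: "\<bar>g y - g x\<bar> \<le> e * Y"
        have "\<bar>(y ^ 5 - x ^ 5) * f y + x ^ 5 * (f y - f x)\<bar> \<le> 5 * T * (e * Y) + G * (e * Y)"
          using 2 3 by linarith
        then have "\<bar>6 * c * ((y ^ 5 - x ^ 5) * f y + x ^ 5 * (f y - f x))\<bar> \<le> 6 * c * (5 * T * (e * Y) + G * (e * Y))"
          using c by (simp add: abs_mult)
        with 1 4 show ?thesis by linarith
      qed
      also have "\<dots> \<le> 6 * c1 * (5 * T * (e * Y) + G * (e * Y)) + e * Y"
        using c T G e Y by (intro add_right_mono mult_right_mono) auto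
      also have "\<dots> = R2 * e * Y" unfolding R2_def by algebra
      finally show ?thesis by (simp add: Y_def)
    qed
    have f_taylor: "\<bar>f (x + e ^ 5) - f x - e ^ 5 * f' x\<bar> \<le> R2 * e ^ 6 * (2 + \<bar>x\<bar>) ^ 8" for x
    proof -
      have "\<exists>z>x. z < x + e ^ 5 \<and> f (x + e ^ 5) - f x = (x + e ^ 5 - x) * f' z"
        by (rule MVT2) (use e5 Df in auto)
      then obtain z where z: "x < z" "z < x + e ^ 5" "f (x + e ^ 5) - f x = e ^ 5 * f' z" by auto
      then have "\<bar>f (x + e ^ 5) - f x - e ^ 5 * f' x\<bar> = e ^ 5 * \<bar>f' z - f' x\<bar>"
        using e5 by (simp add: right_diff_distrib[symmetric] abs_mult)
      also have "\<dots> \<le> e ^ 5 * (R2 * e * (2 + \<bar>x\<bar>) ^ 8)"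
        using z e5 by (intro mult_left_mono f'_incr) auto
      also have "\<dots> = R2 * e ^ 6 * (2 + \<bar>x\<bar>) ^ 8" by (simp add: eval_nat_numeral)
      finally show ?thesis .
    qed
    define L where "L = (\<lambda>x. (1 + 2 * e * x + drift (2 * e * x)) * (f (x + e ^ 5) - f x) + drift (2 * e * x) * f x)"
    define S where "S = (\<lambda>x. f' x - 64 / 5 * (x ^ 5 * f x))"
    have 1: "\<bar>gibbs_mean N L\<bar> \<le> C * e ^ 6 * T"
    proof -
      have "\<bar>gibbs_mean N L\<bar> \<le> C * e ^ 6 * gibbs_mean N (\<lambda>x. \<bar>f (x + e ^ 5)\<bar>)"
        using id[OF N, of f] by (simp add: L_def e_def)
      also have "\<dots> \<le> C * e ^ 6 * gibbs_mean N (\<lambda>x. T)"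
        using C e fT by (intro mult_left_mono gibbs_mean_mono[OF N]) auto
      finally show ?thesis by (simp add: gibbs_mean_const)
    qed
    have 2: "\<bar>gibbs_mean N (\<lambda>x. e ^ 5 * S x - L x)\<bar> \<le> (R1 + R2 + R3) * e ^ 6 * M"
    proof -
      have "\<bar>gibbs_mean N (\<lambda>x. e ^ 5 * S x - L x)\<bar> \<le> gibbs_mean N (\<lambda>x. (R1 + R2 + R3) * e ^ 6 * (2 + \<bar>x\<bar>) ^ 8)"
      proof (rule gibbs_mean_abs_le[OF N])
        fix x assume x: "\<bar>2 * eps N * x\<bar> \<le> 1"
        define s where "s = 2 * e * x"
        define Y where "Y = (2 + \<bar>x\<bar>) ^ 8"
        have s: "\<bar>s\<bar> \<le> 1" using x by (simp add: s_def e_def)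
        have eq: "e ^ 5 * S x - L x = - ((s + drift s) * (f (x + e ^ 5) - f x))
            - (f (x + e ^ 5) - f x - e ^ 5 * f' x) - (drift s + 2 / 5 * s ^ 5) * f x"
          by (simp add: L_def S_def s_def[symmetric])
            (simp add: s_def power_mult_distrib algebra_simps)
        have t1: "\<bar>(s + drift s) * (f (x + e ^ 5) - f x)\<bar> \<le> R1 * e ^ 6 * Y"
        proof -
          have "\<bar>(s + drift s) * (f (x + e ^ 5) - f x)\<bar> \<le> ((7 / 5 + K) * \<bar>s\<bar>) * (G * (2 + \<bar>x\<bar>) * e ^ 5)"
            unfolding abs_mult using f_incr[of x "x + e ^ 5"] e5 G K0
            by (intro mult_mono drift_linear_bound[OF K s]) auto
          also have "\<dots> = R1 * e ^ 6 * (\<bar>x\<bar> * (2 + \<bar>x\<bar>))"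
            using e by (simp add: R1_def s_def abs_mult eval_nat_numeral)
          also have "\<dots> \<le> R1 * e ^ 6 * (2 + \<bar>x\<bar>) ^ 2"
            unfolding power2_eq_square using R e by (intro mult_left_mono mult_right_mono) auto
          also have "\<dots> \<le> R1 * e ^ 6 * Y"
            unfolding Y_def using R e by (intro mult_left_mono le_two_plus_abs_power8) auto
          finally show ?thesis .
        qed
        have t3: "\<bar>(drift s + 2 / 5 * s ^ 5) * f x\<bar> \<le> R3 * e ^ 6 * Y"
        proof -
          have "\<bar>(drift s + 2 / 5 * s ^ 5) * f x\<bar> \<le> K * s ^ 6 * T"
            unfolding abs_mult using K[OF s] fT K0 by (intro mult_mono) auto
          also have "\<dots> = R3 * e ^ 6 * \<bar>x\<bar> ^ 6" by (simp add: R3_def s_def power_mult_distrib)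
          also have "\<dots> \<le> R3 * e ^ 6 * Y"
            unfolding Y_def using R e by (intro mult_left_mono abs_power_le_two_plus_abs_power8) auto
          finally show ?thesis .
        qed
        have t2: "\<bar>f (x + e ^ 5) - f x - e ^ 5 * f' x\<bar> \<le> R2 * e ^ 6 * Y"
          unfolding Y_def by (rule f_taylor)
        have "\<bar>e ^ 5 * S x - L x\<bar> \<le> R1 * e ^ 6 * Y + R2 * e ^ 6 * Y + R3 * e ^ 6 * Y"
          unfolding eq using t1 t2 t3 by linarith
        then show "\<bar>e ^ 5 * S x - L x\<bar> \<le> (R1 + R2 + R3) * e ^ 6 * (2 + \<bar>x\<bar>) ^ 8"
          by (simp add: Y_def distrib_right)
      qed
      also have "\<dots> \<le> (R1 + R2 + R3) * e ^ 6 * M"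
        unfolding gibbs_mean_cmult using M(2)[OF N] R e by (intro mult_left_mono) auto
      finally show ?thesis .
    qed
    have 3: "\<bar>gibbs_mean N S\<bar> \<le> (C * T + (R1 + R2 + R3) * M) * e"
    proof -
      have "gibbs_mean N (\<lambda>x. e ^ 5 * S x - L x) = e ^ 5 * gibbs_mean N S - gibbs_mean N L" by (simp only: gibbs_mean_diff gibbs_mean_cmult)
      with 1 2 have "\<bar>e ^ 5 * gibbs_mean N S\<bar> \<le> C * e ^ 6 * T + (R1 + R2 + R3) * e ^ 6 * M" by linarith
      also have "\<dots> = e ^ 5 * ((C * T + (R1 + R2 + R3) * M) * e)" by algebra
      finally show ?thesis using e5 by (simp add: abs_mult)
    qed
    have 4: "\<bar>gibbs_mean N (\<lambda>x. (64 / 5 - 1 / a) * (x ^ 5 * f x))\<bar> \<le> Ca / a0 * T * M * e"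
    proof -
      have "\<bar>64 / 5 - 1 / a\<bar> = \<bar>1 - 64 / 5 * a\<bar> / a"
        using a by (simp add: field_simps abs_minus_commute)
      also have "\<dots> \<le> Ca * e / a0"
        using Ca(2)[OF N] Ca(1) a a0 e by (intro frac_le) (auto simp: a_def e_def)
      finally have d: "\<bar>64 / 5 - 1 / a\<bar> \<le> Ca / a0 * e" by simp
      have "\<bar>gibbs_mean N (\<lambda>x. (64 / 5 - 1 / a) * (x ^ 5 * f x))\<bar> \<le> gibbs_mean N (\<lambda>x. Ca / a0 * e * T * (2 + \<bar>x\<bar>) ^ 8)"
      proof (rule gibbs_mean_abs_le[OF N])
        fix x
        have "\<bar>x ^ 5 * f x\<bar> = x ^ 4 * \<bar>f x\<bar> * \<bar>x\<bar> ^ 1"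
          by (simp add: abs_mult power_abs eval_nat_numeral)
        also have "\<dots> \<le> T * (2 + \<bar>x\<bar>) ^ 8"
          using fT T by (intro mult_mono abs_power_le_two_plus_abs_power8) auto
        finally have "\<bar>64 / 5 - 1 / a\<bar> * \<bar>x ^ 5 * f x\<bar> \<le> Ca / a0 * e * (T * (2 + \<bar>x\<bar>) ^ 8)"
          using d Ca a0 e by (intro mult_mono) auto
        then show "\<bar>(64 / 5 - 1 / a) * (x ^ 5 * f x)\<bar> \<le> Ca / a0 * e * T * (2 + \<bar>x\<bar>) ^ 8"
          by (simp only: abs_mult mult.assoc)
      qed
      also have "\<dots> \<le> Ca / a0 * e * T * M"
        unfolding gibbs_mean_cmult using M(2)[OF N] Ca a0 e T by (intro mult_left_mono) auto
      finally show ?thesis by (simp only: mult_ac)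
    qed
    have "(\<lambda>x. g x) = (\<lambda>x. S x + ((64 / 5 - 1 / a) * (x ^ 5 * f x) + Eg))"
      using a by (auto simp: S_def f'_def \<phi>_def c_def field_simps)
    then have "gibbs_mean N g = gibbs_mean N S + (gibbs_mean N (\<lambda>x. (64 / 5 - 1 / a) * (x ^ 5 * f x)) + Eg)"
      by (simp only: gibbs_mean_add gibbs_mean_const)
    then have "\<bar>gibbs_mean N g - Eg\<bar> \<le> (C * T + (R1 + R2 + R3) * M) * e + Ca / a0 * T * M * e"
      using 3 4 by linarith
    also have "\<dots> = CC * e" unfolding CC_def by algebra
    finally show ?thesis by (simp add: Eg_def a_def e_def)
  qed
  moreover have "CC \<ge> 0" using C T R M Ca a0 by (simp add: CC_def)
  ultimately show ?thesis by blast
qed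

section \<open>Wasserstein and Kolmogorov distances\<close>

lemma wasserstein_bound:
  obtains C where "C \<ge> 0"
    "\<And>N g. N \<ge> 1 \<Longrightarrow> 1-lipschitz_on UNIV g \<Longrightarrow>
      \<bar>gibbs_mean N g - (LINT x|sextic_law (sixth_moment N). g x)\<bar> \<le> C * eps N"
proof -
  obtain C where C: "C \<ge> 0" and cmp:
    "\<forall>N\<ge>1. \<forall>g. (\<forall>x y. \<bar>g x - g y\<bar> \<le> \<bar>x - y\<bar> / eps N) \<longrightarrow> (\<forall>x. \<bar>g x\<bar> \<le> 1 + \<bar>x\<bar>) \<longrightarrow>
      \<bar>gibbs_mean N g - (LINT x|sextic_law (sixth_moment N). g x)\<bar> \<le> C * eps N"
    using stein_comparison by (elim exE conjE) (rule that)
  have "\<bar>gibbs_mean N g - (LINT x|sextic_law (sixth_moment N). g x)\<bar> \<le> C * eps N"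
    if N: "N \<ge> 1" and g: "1-lipschitz_on UNIV g" for N and g :: "real \<Rightarrow> real"
  proof -
    let ?Z = "sextic_law (sixth_moment N)"
    interpret Z: prob_space ?Z by (rule prob_space_sextic_law[OF sixth_moment_pos[OF N]])
    have lip: "\<bar>g x - g y\<bar> \<le> \<bar>x - y\<bar>" for x y
      using lipschitz_onD[OF g, of x y] by (simp add: dist_real_def)
    have meas: "g \<in> borel_measurable borel"
      using lipschitz_on_continuous_on[OF g] by (rule borel_measurable_continuous_onI)
    have int: "integrable ?Z g"
    proof (rule integrable_sextic_law[OF sixth_moment_pos[OF N] meas, where A = "1 + \<bar>g 0\<bar>"])
      fix x
      have "\<bar>g x\<bar> \<le> \<bar>g 0\<bar> + 1 * \<bar>x\<bar>" using lip[of x 0] by simp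
      also have "\<dots> \<le> (1 + \<bar>g 0\<bar>) * (1 + \<bar>x\<bar>)" by (simp add: algebra_simps)
      finally show "\<bar>g x\<bar> \<le> (1 + \<bar>g 0\<bar>) * (1 + \<bar>x\<bar>)" .
    qed
    have "\<bar>gibbs_mean N (\<lambda>x. g x - g 0) - (LINT x|?Z. g x - g 0)\<bar> \<le> C * eps N"
    proof (rule cmp[rule_format, OF N])
      fix x y
      have "\<bar>x - y\<bar> \<le> \<bar>x - y\<bar> / eps N"
        using eps_bounds[OF N] by (simp add: le_divide_eq mult_left_le)
      then show "\<bar>g x - g 0 - (g y - g 0)\<bar> \<le> \<bar>x - y\<bar> / eps N" using lip[of x y] by simp
    next
      fix x show "\<bar>g x - g 0\<bar> \<le> 1 + \<bar>x\<bar>" using lip[of x 0] by simp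
    qed
    moreover have "(LINT x|?Z. g x - g 0) = (LINT x|?Z. g x) - g 0"
      using int by (simp add: Z.prob_space[simplified])
    moreover have "gibbs_mean N (\<lambda>x. g x - g 0) = gibbs_mean N g - g 0" by (simp only: gibbs_mean_diff gibbs_mean_const)
    ultimately show ?thesis by simp
  qed
  with C show thesis by (intro that) auto
qed

definition ramp :: "real \<Rightarrow> real \<Rightarrow> real \<Rightarrow> real" where
  "ramp e t x = max 0 (min 1 ((t + e - x) / e))"

lemma ramp_properties:
  assumes e: "e > 0"
  shows "indicator {..t} x \<le> ramp e t x" "ramp e t x \<le> indicator {..t + e} x"
    and "\<bar>ramp e t x - ramp e t y\<bar> \<le> \<bar>x - y\<bar> / e" "0 \<le> ramp e t x" "ramp e t x \<le> 1"
proof -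
  show "indicator {..t} x \<le> ramp e t x" using e by (auto simp: ramp_def indicator_def)
  show "ramp e t x \<le> indicator {..t + e} x"
    using e by (auto simp: ramp_def indicator_def divide_le_0_iff)
  have "(t + e - x) / e - (t + e - y) / e = - ((x - y) / e)" by (simp add: diff_divide_distrib add_divide_distrib)
  moreover have "\<bar>x - y\<bar> / e = \<bar>(x - y) / e\<bar>" using e by simp
  ultimately show "\<bar>ramp e t x - ramp e t y\<bar> \<le> \<bar>x - y\<bar> / e"
    unfolding ramp_def by (auto simp: max_def min_def abs_if)
qed (auto simp: ramp_def)

text \<open>
  The indicator of \<open>(-\<infinity>, t]\<close> lies between the ramps of width \<open>e\<close> ending at \<open>t\<close> and starting at \<open>t\<close>.
  Their means are compared by \<open>stein_comparison\<close>, and the sextic law gives mass \<open>O(e)\<close> to an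
  interval of length \<open>e\<close>.
\<close>

lemma kolmogorov_bound:
  obtains C where "C \<ge> 0"
    "\<And>N t. N \<ge> 1 \<Longrightarrow>
      \<bar>gibbs_mean N (indicator {..t}) - cdf (sextic_law (sixth_moment N)) t\<bar> \<le> C * eps N"
proof -
  obtain C where C: "C \<ge> 0" and cmp:
    "\<forall>N\<ge>1. \<forall>g. (\<forall>x y. \<bar>g x - g y\<bar> \<le> \<bar>x - y\<bar> / eps N) \<longrightarrow> (\<forall>x. \<bar>g x\<bar> \<le> 1 + \<bar>x\<bar>) \<longrightarrow>
      \<bar>gibbs_mean N g - (LINT x|sextic_law (sixth_moment N). g x)\<bar> \<le> C * eps N"
    using stein_comparison by (elim exE conjE) (rule that)
  obtain a0 a1 where a0: "0 < a0" "\<And>N. N \<ge> 1 \<Longrightarrow> a0 \<le> sixth_moment N"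
    and "\<And>N. N \<ge> 1 \<Longrightarrow> sixth_moment N \<le> a1"
    using sixth_moment_bounds by blast
  define D where "D = 1 / sextic_mass (1 / (6 * a0))"
  have D: "D \<ge> 0" using sextic_mass_pos[of "1 / (6 * a0)"] a0 by (simp add: D_def)
  have "\<bar>gibbs_mean N (indicator {..t}) - cdf (sextic_law (sixth_moment N)) t\<bar> \<le> (C + D) * eps N" if N: "N \<ge> 1" for N t
  proof -
    let ?Z = "sextic_law (sixth_moment N)"
    define e where "e = eps N"
    have e: "e > 0" using eps_bounds[OF N] by (simp add: e_def)
    have pos: "sixth_moment N > 0" by (rule sixth_moment_pos[OF N])
    interpret Z: prob_space ?Z by (rule prob_space_sextic_law[OF pos])
    interpret R: finite_borel_measure ?Z by unfold_locales simp
    have ind_int: "integrable ?Z (indicator {..u} :: real \<Rightarrow> real)" for u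
      by (rule integrable_sextic_law[OF pos, where A = 1]) (auto simp: indicator_def)
    have ramp_meas: "ramp e u \<in> borel_measurable borel" for u
      unfolding ramp_def[abs_def] by measurable
    have ramp_int: "integrable ?Z (ramp e u)" for u
    proof (rule integrable_sextic_law[OF pos ramp_meas, where A = 1])
      fix x show "\<bar>ramp e u x\<bar> \<le> 1 * (1 + \<bar>x\<bar>)" using ramp_properties(4,5)[OF e, of u x] by simp
    qed
    have cdf_int: "(LINT x|?Z. indicator {..u} x) = cdf ?Z u" for u
      by (simp add: cdf_def)
    have ramp_cmp: "\<bar>gibbs_mean N (ramp e u) - (LINT x|?Z. ramp e u x)\<bar> \<le> C * e" for u
      unfolding e_def
    proof (rule cmp[rule_format, OF N])
      fix x show "\<bar>ramp (eps N) u x\<bar> \<le> 1 + \<bar>x\<bar>"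
        using ramp_properties(4,5)[OF e, of u x] by (simp add: e_def)
    qed (use ramp_properties(3)[OF e] in \<open>simp add: e_def\<close>)
    have ramp_lo: "cdf ?Z u \<le> (LINT x|?Z. ramp e u x)" and ramp_hi: "(LINT x|?Z. ramp e u x) \<le> cdf ?Z (u + e)" for u
      unfolding cdf_int[symmetric]
      by (rule integral_mono[OF ind_int ramp_int ramp_properties(1)[OF e]],
          rule integral_mono[OF ramp_int ind_int ramp_properties(2)[OF e]])
    have step: "cdf ?Z (u + e) \<le> cdf ?Z u + D * e" for u
    proof -
      have "cdf ?Z (u + e) - cdf ?Z u = measure ?Z {u<..u + e}"
        using e by (intro R.cdf_diff_eq) simp
      also have "\<dots> \<le> e / sextic_mass (1 / (6 * sixth_moment N))"
        by (rule sextic_law_interval[OF pos refl]) (use e in simp)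
      also have "\<dots> \<le> e / sextic_mass (1 / (6 * a0))"
        using a0 N pos e
        by (intro divide_left_mono sextic_mass_antimono mult_pos_pos sextic_mass_pos)
          (auto intro!: divide_left_mono)
      finally show ?thesis by (simp add: D_def)
    qed
    have "gibbs_mean N (indicator {..t}) \<le> gibbs_mean N (ramp e t)"
      by (intro gibbs_mean_mono[OF N] ramp_properties(1)[OF e])
    then have up: "gibbs_mean N (indicator {..t}) \<le> cdf ?Z t + D * e + C * e"
      using ramp_cmp[of t] ramp_hi[of t] step[of t] by linarith
    have "gibbs_mean N (ramp e (t - e)) \<le> gibbs_mean N (indicator {..t})"
      using ramp_properties(2)[OF e, of "t - e"] by (intro gibbs_mean_mono[OF N]) simp
    then have lo: "cdf ?Z t - D * e - C * e \<le> gibbs_mean N (indicator {..t})"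
      using ramp_cmp[of "t - e"] ramp_lo[of "t - e"] step[of "t - e"] by simp
    have "\<bar>gibbs_mean N (indicator {..t}) - cdf ?Z t\<bar> \<le> C * e + D * e"
      using up lo by linarith
    then show ?thesis by (simp add: e_def distrib_right)
  qed
  with C D show thesis by (intro that[of "C + D"]) auto
qed

lemma fluctuation_eq_fluct:
  assumes N: "N \<ge> 1" and F: "is_fluctuation 2 N (x_vec 2 0) F" and X: "X \<in> configs 2 N"
  shows "F X = fluct N X"
proof -
  have "magnetization N X 2 - x_vec 2 0 2 = real N powr (- 1 / 6) * F X * u_vec 2"
    using F X unfolding is_fluctuation_def by simp
  then have "magnetization N X 2 - 1 / 2 = eps N * F X"
    unfolding x_vec_2 by (simp add: u_vec_def eps_def)
  then show ?thesis using eps_bounds[OF N] by (simp add: fluct_def)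
qed

theorem theorem3p7:
  fixes p q :: nat and \<beta> h :: real and m :: "nat \<Rightarrow> real"
  assumes "p \<ge> 2" and "q \<ge> 2" and "\<beta> > 0" and "h \<ge> 0"
    and "special_type_II p q \<beta> h"
    and "unique_global_maximizer p q \<beta> h m"
  shows "\<exists>C>0. \<forall>N\<ge>1. \<forall>F. is_fluctuation q N m F \<longrightarrow>
    (let P = potts p q \<beta> h N;
         Z = sextic_law (LINT X|P. F X ^ 6)
     in (\<forall>g :: real \<Rightarrow> real. 1-lipschitz_on UNIV g \<longrightarrow>
           \<bar>(LINT X|P. g (F X)) - (LINT x|Z. g x)\<bar> \<le> C / real N powr (1 / 6)) \<and>
        (SUP t. \<bar>measure P {X \<in> space P. F X \<le> t} - cdf Z t\<bar>) \<le> C / real N powr (1 / 6))"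
proof (cases "q = 2")
  case False
  then have "q > 2" using assms by simp
  then show ?thesis using no_fluctuation_if_q_gt_2 by (intro exI[of _ 1]) auto
next
  case q: True
  have par: "p = 4" "\<beta> = 2 / 3" "h = 0" "m = x_vec 2 0"
    using special_type_II_parameters[of p \<beta> h m] assms by (auto simp: q)
  obtain CW where CW: "CW \<ge> 0"
    "\<And>N g. N \<ge> 1 \<Longrightarrow> 1-lipschitz_on UNIV g \<Longrightarrow>
      \<bar>gibbs_mean N g - (LINT x|sextic_law (sixth_moment N). g x)\<bar> \<le> CW * eps N"
    using wasserstein_bound by blast
  obtain CK where CK: "CK \<ge> 0"
    "\<And>N t. N \<ge> 1 \<Longrightarrow>
      \<bar>gibbs_mean N (indicator {..t}) - cdf (sextic_law (sixth_moment N)) t\<bar> \<le> CK * eps N"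
    using kolmogorov_bound by blast
  define C where "C = CW + CK + 1"
  have C: "C > 0" using CW CK by (simp add: C_def)
  show ?thesis
  proof (intro exI[of _ C] conjI C allI impI)
    fix N :: nat and F assume N: "N \<ge> 1" and F: "is_fluctuation q N m F"
    define P where "P = potts p q \<beta> h N"
    have P: "P = potts 4 2 (2 / 3) 0 N" by (simp add: P_def par q)
    have sp: "space P = configs 2 N" by (simp add: P potts_def space_point_measure)
    have Feq: "F X = fluct N X" if "X \<in> configs 2 N" for X
      using fluctuation_eq_fluct[OF N _ that] F by (simp add: q par)
    have int: "(LINT X|P. \<phi> (F X)) = gibbs_mean N \<phi>" for \<phi>
      unfolding P integral_potts gibbs_mean_def using Feq by simp
    have rate: "C / real N powr (1 / 6) = C * eps N"
      by (simp add: eps_def powr_minus_divide)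
    have CC: "CW * eps N \<le> C * eps N" "CK * eps N \<le> C * eps N"
      using CW CK eps_bounds[OF N] by (auto simp: C_def intro!: mult_right_mono)
    have a: "(LINT X|P. F X ^ 6) = sixth_moment N"
      using int[of "\<lambda>x. x ^ 6"] by (simp add: sixth_moment_def)
    have "\<bar>measure P {X \<in> space P. F X \<le> t} - cdf (sextic_law (sixth_moment N)) t\<bar> \<le> C * eps N" for t
    proof -
      have "{X \<in> space P. F X \<le> t} = {X \<in> space P. fluct N X \<le> t}" using Feq by (auto simp: sp)
      then have "measure P {X \<in> space P. F X \<le> t} = gibbs_mean N (indicator {..t})"
        using measure_potts[of N t] by (simp add: P)
      then show ?thesis using CK(2)[OF N, of t] CC by linarith
    qed
    then have K: "(SUP t. \<bar>measure P {X \<in> space P. F X \<le> t} - cdf (sextic_law (sixth_moment N)) t\<bar>) \<le> C * eps N"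
      by (intro cSUP_least) auto
    have W: "\<forall>g :: real \<Rightarrow> real. 1-lipschitz_on UNIV g \<longrightarrow>
        \<bar>(LINT X|P. g (F X)) - (LINT x|sextic_law (sixth_moment N). g x)\<bar> \<le> C * eps N"
      unfolding int using CW(2)[OF N] CC by (meson order.trans)
    show "let P = potts p q \<beta> h N;
         Z = sextic_law (LINT X|P. F X ^ 6)
     in (\<forall>g :: real \<Rightarrow> real. 1-lipschitz_on UNIV g \<longrightarrow>
           \<bar>(LINT X|P. g (F X)) - (LINT x|Z. g x)\<bar> \<le> C / real N powr (1 / 6)) \<and>
        (SUP t. \<bar>measure P {X \<in> space P. F X \<le> t} - cdf Z t\<bar>) \<le> C / real N powr (1 / 6)"
      unfolding P_def[symmetric] Let_def a rate using W K by blast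
  qed
qed

end
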